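(* Let $\Gamma$ be an uncountable set. Then $c_0(\Gamma)$ belongs to $\mathcal E\cap\mathcal E_0$, and for every $1<p<\infty$ the space $\ell_p(\Gamma)$ belongs to $\mathcal E\cap\mathcal E_0$.
   Context: Compact spaces are Hausdorff. For a compact space $K$, $\mathcal Q(K)$ is the set of all Hausdorff quotient spaces $L=K/E$ ($E$ an equivalence relation on $K$, quotient topology), each with its canonical projection $p_L:K\to L$. It is ordered by: $L\le L'$ iff there is a continuous surjection $q:L'\to L$ (the natural projection) with $q\,p_{L'}=p_L$; equivalently, the equivalence relation of $L'$ is contained in that of $L$. Suprema in $\mathcal Q(K)$ correspond to intersections of equivalence relations. $\mathcal Q_\omega(K)\subset\mathcal Q(K)$ is the set of quotients of countable weight. A family $\mathcal S\subset\mathcal Q_\omega(K)$ is cofinal if for every $L\in\mathcal Q_\omega(K)$ there is $L'\in\mathcal S$ with $L\le L'$; it is a $\sigma$-semilattice if the supremum of every countable subset of $\mathcal S$ belongs to $\mathcal S$. Given a continuous surjection $\pi:M\to N$, a sequence $(x_n)$ in $N$ converging to $x\in N$ is called $\pi$-fiber convergent if for every $y\in\pi^{-1}(x)$ there are $y_n\in\pi^{-1}(x_n)$ with $y_n\to y$. If $K$ is a compact space of uncountable weight and $(x_n)$ is a sequence in $K$ converging to $x\in K$, then $(x_n)$ is called fiber convergent if there is a cofinal $\sigma$-semilattice $\mathcal S\subset\mathcal Q_\omega(K)$ such that for all $L'\le L$ in $\mathcal S$, with natural projection $\pi:L\to L'$, the sequence $(p_{L'}(x_n))_n$ (which converges to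 $p_{L'}(x)$) is $\pi$-fiber convergent. A nonseparable Banach space $X$ belongs to the class $\mathcal E$ if the fiber convergent sequences of $(B_{X^\ast},w^\ast)$ are exactly the norm convergent sequences of $B_{X^\ast}$. It belongs to the class $\mathcal E_0$ if the fiber convergent sequences of $(B_{X^\ast},w^\ast)$ are exactly those sequences $(x_n^\ast)$ in $B_{X^\ast}$ that are weak$^\ast$ convergent to a point $x^\ast\in B_{X^\ast}$ with $\|x_n^\ast\|\to\|x^\ast\|$. Here $B_{X^\ast}$ is the closed unit ball of the dual $X^\ast$. *)

theory Defs
  imports "HOL-Analysis.Analysis" "HOL-Library.Function_Algebras"
begin

section \<open>Hausdorff quotients of a compact space\<close>

definition countable_weight :: "'a topology \<Rightarrow> bool" where
  "countable_weight X \<longleftrightarrow>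
     (\<exists>\<B>. countable \<B> \<and> (\<forall>V\<in>\<B>. openin X V) \<and>
          (\<forall>U x. openin X U \<and> x \<in> U \<longrightarrow> (\<exists>V\<in>\<B>. x \<in> V \<and> V \<subseteq> U)))"

text \<open>A quotient \<open>L = K/E\<close> is represented by its equivalence relation \<open>E\<close> on \<open>topspace K\<close>;
  its points are the equivalence classes and its projection \<open>p\<^sub>L\<close> is \<open>\<lambda>x. E `` {x}\<close>.\<close>

definition quotient_space :: "'a topology \<Rightarrow> ('a \<times> 'a) set \<Rightarrow> 'a set topology" where
  "quotient_space K E =
     topology (\<lambda>U. U \<subseteq> topspace K // E \<and> openin K {x \<in> topspace K. E `` {x} \<in> U})"

lemma openin_quotient_space:
  "openin (quotient_space K E) U \<longleftrightarrow>
     U \<subseteq> topspace K // E \<and> openin K {x \<in> topspace K. E `` {x} \<in> U}"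
proof -
  have "istopology (\<lambda>U. U \<subseteq> topspace K // E \<and> openin K {x \<in> topspace K. E `` {x} \<in> U})"
    unfolding istopology_def
  proof (intro conjI allI impI)
    fix S T
    assume S: "S \<subseteq> topspace K // E \<and> openin K {x \<in> topspace K. E `` {x} \<in> S}"
      and T: "T \<subseteq> topspace K // E \<and> openin K {x \<in> topspace K. E `` {x} \<in> T}"
    show "S \<inter> T \<subseteq> topspace K // E" using S by blast
    have "{x \<in> topspace K. E `` {x} \<in> S \<inter> T} =
      {x \<in> topspace K. E `` {x} \<in> S} \<inter> {x \<in> topspace K. E `` {x} \<in> T}" by blast
    then show "openin K {x \<in> topspace K. E `` {x} \<in> S \<inter> T}" using S T by auto
  next
    fix \<K>
    assume *: "\<forall>S\<in>\<K>. S \<subseteq> topspace K // E \<and> openin K {x \<in> topspace K. E `` {x} \<in> S}"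
    show "\<Union> \<K> \<subseteq> topspace K // E" using * by blast
    have "{x \<in> topspace K. E `` {x} \<in> \<Union> \<K>} =
      \<Union> ((\<lambda>S. {x \<in> topspace K. E `` {x} \<in> S}) ` \<K>)" by blast
    then show "openin K {x \<in> topspace K. E `` {x} \<in> \<Union> \<K>}" using * by auto
  qed
  then show ?thesis by (simp add: quotient_space_def)
qed

lemma topspace_quotient_space: "topspace (quotient_space K E) = topspace K // E"
proof (rule antisym)
  show "topspace (quotient_space K E) \<subseteq> topspace K // E"
    using openin_quotient_space openin_topspace by blast
  have "{x \<in> topspace K. E `` {x} \<in> topspace K // E} = topspace K"
    by (auto intro: quotientI)
  then have "openin (quotient_space K E) (topspace K // E)"
    by (simp add: openin_quotient_space)
  then show "topspace K // E \<subseteq> topspace (quotient_space K E)"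
    by (rule openin_subset)
qed

definition Quotients :: "'a topology \<Rightarrow> ('a \<times> 'a) set set" where
  "Quotients K = {E. equiv (topspace K) E \<and> Hausdorff_space (quotient_space K E)}"

definition Quotients_omega :: "'a topology \<Rightarrow> ('a \<times> 'a) set set" where
  "Quotients_omega K = {E \<in> Quotients K. countable_weight (quotient_space K E)}"

text \<open>\<open>q\<close> is the natural projection from \<open>K/E'\<close> onto \<open>K/E\<close>; it is unique on \<open>topspace K // E'\<close>.\<close>

definition natural_projection ::
  "'a topology \<Rightarrow> ('a \<times> 'a) set \<Rightarrow> ('a \<times> 'a) set \<Rightarrow> ('a set \<Rightarrow> 'a set) \<Rightarrow> bool" where
  "natural_projection K E' E q \<longleftrightarrow>
     continuous_map (quotient_space K E') (quotient_space K E) q \<and>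
     q ` topspace (quotient_space K E') = topspace (quotient_space K E) \<and>
     (\<forall>x\<in>topspace K. q (E' `` {x}) = E `` {x})"

definition quotient_le :: "'a topology \<Rightarrow> ('a \<times> 'a) set \<Rightarrow> ('a \<times> 'a) set \<Rightarrow> bool" where
  "quotient_le K E E' \<longleftrightarrow> (\<exists>q. natural_projection K E' E q)"

definition is_quotient_sup :: "'a topology \<Rightarrow> ('a \<times> 'a) set set \<Rightarrow> ('a \<times> 'a) set \<Rightarrow> bool" where
  "is_quotient_sup K \<A> E \<longleftrightarrow>
     E \<in> Quotients K \<and> (\<forall>D\<in>\<A>. quotient_le K D E) \<and>
     (\<forall>F\<in>Quotients K. (\<forall>D\<in>\<A>. quotient_le K D F) \<longrightarrow> quotient_le K E F)"

definition cofinal_family :: "'a topology \<Rightarrow> ('a \<times> 'a) set set \<Rightarrow> bool" where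
  "cofinal_family K \<S> \<longleftrightarrow>
     \<S> \<subseteq> Quotients_omega K \<and> (\<forall>E\<in>Quotients_omega K. \<exists>E'\<in>\<S>. quotient_le K E E')"

definition sigma_semilattice :: "'a topology \<Rightarrow> ('a \<times> 'a) set set \<Rightarrow> bool" where
  "sigma_semilattice K \<S> \<longleftrightarrow>
     \<S> \<subseteq> Quotients_omega K \<and>
     (\<forall>\<A>\<subseteq>\<S>. countable \<A> \<longrightarrow> (\<exists>E\<in>\<S>. is_quotient_sup K \<A> E))"

section \<open>Fiber convergence\<close>

definition map_fiber_convergent ::
  "'a topology \<Rightarrow> 'b topology \<Rightarrow> ('a \<Rightarrow> 'b) \<Rightarrow> (nat \<Rightarrow> 'b) \<Rightarrow> 'b \<Rightarrow> bool" where
  "map_fiber_convergent M N \<pi> xs x \<longleftrightarrow>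
     continuous_map M N \<pi> \<and> \<pi> ` topspace M = topspace N \<and>
     (\<forall>n. xs n \<in> topspace N) \<and> limitin N xs x sequentially \<and>
     (\<forall>y\<in>topspace M. \<pi> y = x \<longrightarrow>
        (\<exists>ys. (\<forall>n. ys n \<in> topspace M \<and> \<pi> (ys n) = xs n) \<and> limitin M ys y sequentially))"

definition fiber_convergent :: "'a topology \<Rightarrow> (nat \<Rightarrow> 'a) \<Rightarrow> bool" where
  "fiber_convergent K xs \<longleftrightarrow>
     compact_space K \<and> Hausdorff_space K \<and> \<not> countable_weight K \<and>
     (\<forall>n. xs n \<in> topspace K) \<and>
     (\<exists>x. limitin K xs x sequentially \<and>
        (\<exists>\<S>. cofinal_family K \<S> \<and> sigma_semilattice K \<S> \<and>
           (\<forall>E\<in>\<S>. \<forall>E'\<in>\<S>. \<forall>\<pi>. quotient_le K E' E \<and> natural_projection K E E' \<pi> \<longrightarrow>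
              map_fiber_convergent (quotient_space K E) (quotient_space K E') \<pi>
                (\<lambda>n. E' `` {xs n}) (E' `` {x}))))"

section \<open>Banach spaces given by a carrier and a norm\<close>

text \<open>A normed space is a linear subspace \<open>V\<close> of an ambient real vector space together with a
  function \<open>N\<close> that is a norm on \<open>V\<close>; this lets the space depend on parameters such as the
  exponent \<open>p\<close>. Functionals on \<open>V\<close> are \<open>undefined\<close> outside \<open>V\<close>.\<close>

definition normed_space_on :: "'v::real_vector set \<Rightarrow> ('v \<Rightarrow> real) \<Rightarrow> bool" where
  "normed_space_on V N \<longleftrightarrow>
     subspace V \<and>
     (\<forall>x\<in>V. 0 \<le> N x \<and> (N x = 0 \<longleftrightarrow> x = 0)) \<and>
     (\<forall>c. \<forall>x\<in>V. N (c *\<^sub>R x) = \<bar>c\<bar> * N x) \<and>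
     (\<forall>x\<in>V. \<forall>y\<in>V. N (x + y) \<le> N x + N y)"

text \<open>The locale \<open>Metric_space\<close> requires its distance to be symmetric and nonnegative on the
  whole type, hence the value \<open>0\<close> off \<open>V\<close>.\<close>

definition norm_dist :: "'v::real_vector set \<Rightarrow> ('v \<Rightarrow> real) \<Rightarrow> 'v \<Rightarrow> 'v \<Rightarrow> real" where
  "norm_dist V N x y = (if x \<in> V \<and> y \<in> V then N (x - y) else 0)"

definition banach_space_on :: "'v::real_vector set \<Rightarrow> ('v \<Rightarrow> real) \<Rightarrow> bool" where
  "banach_space_on V N \<longleftrightarrow>
     normed_space_on V N \<and> Metric_space.mcomplete V (norm_dist V N)"

definition separable_on :: "'v::real_vector set \<Rightarrow> ('v \<Rightarrow> real) \<Rightarrow> bool" where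
  "separable_on V N \<longleftrightarrow>
     (\<exists>C\<subseteq>V. countable C \<and> Metric_space.mtopology V (norm_dist V N) closure_of C = V)"

definition dual_space :: "'v::real_vector set \<Rightarrow> ('v \<Rightarrow> real) \<Rightarrow> ('v \<Rightarrow> real) set" where
  "dual_space V N =
     {\<phi> \<in> extensional V.
        (\<forall>x\<in>V. \<forall>y\<in>V. \<phi> (x + y) = \<phi> x + \<phi> y) \<and>
        (\<forall>c. \<forall>x\<in>V. \<phi> (c *\<^sub>R x) = c * \<phi> x) \<and>
        (\<exists>C. \<forall>x\<in>V. \<bar>\<phi> x\<bar> \<le> C * N x)}"

definition dual_norm :: "'v::real_vector set \<Rightarrow> ('v \<Rightarrow> real) \<Rightarrow> ('v \<Rightarrow> real) \<Rightarrow> real" where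
  "dual_norm V N \<phi> = (SUP x\<in>{x \<in> V. N x \<le> 1}. \<bar>\<phi> x\<bar>)"

definition dual_ball :: "'v::real_vector set \<Rightarrow> ('v \<Rightarrow> real) \<Rightarrow> ('v \<Rightarrow> real) set" where
  "dual_ball V N = {\<phi> \<in> dual_space V N. dual_norm V N \<phi> \<le> 1}"

definition weak_star_ball :: "'v::real_vector set \<Rightarrow> ('v \<Rightarrow> real) \<Rightarrow> ('v \<Rightarrow> real) topology" where
  "weak_star_ball V N = subtopology (product_topology (\<lambda>_. euclideanreal) V) (dual_ball V N)"

definition class_E :: "'v::real_vector set \<Rightarrow> ('v \<Rightarrow> real) \<Rightarrow> bool" where
  "class_E V N \<longleftrightarrow>
     banach_space_on V N \<and> \<not> separable_on V N \<and>
     (\<forall>xs :: nat \<Rightarrow> 'v \<Rightarrow> real. (\<forall>n. xs n \<in> dual_ball V N) \<longrightarrow>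
        (fiber_convergent (weak_star_ball V N) xs \<longleftrightarrow>
         (\<exists>x\<in>dual_ball V N. (\<lambda>n. dual_norm V N (\<lambda>v. xs n v - x v)) \<longlonglongrightarrow> 0)))"

definition class_E0 :: "'v::real_vector set \<Rightarrow> ('v \<Rightarrow> real) \<Rightarrow> bool" where
  "class_E0 V N \<longleftrightarrow>
     banach_space_on V N \<and> \<not> separable_on V N \<and>
     (\<forall>xs :: nat \<Rightarrow> 'v \<Rightarrow> real. (\<forall>n. xs n \<in> dual_ball V N) \<longrightarrow>
        (fiber_convergent (weak_star_ball V N) xs \<longleftrightarrow>
         (\<exists>x\<in>dual_ball V N. limitin (weak_star_ball V N) xs x sequentially \<and>
            (\<lambda>n. dual_norm V N (xs n)) \<longlonglongrightarrow> dual_norm V N x)))"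

section \<open>The spaces \<open>c\<^sub>0(\<Gamma>)\<close> and \<open>\<ell>\<^sub>p(\<Gamma>)\<close>\<close>

instantiation "fun" :: (type, real_vector) real_vector
begin

definition scaleR_fun :: "real \<Rightarrow> ('a \<Rightarrow> 'b) \<Rightarrow> 'a \<Rightarrow> 'b" where
  "scaleR_fun c f = (\<lambda>x. c *\<^sub>R f x)"

instance
  by standard (auto simp: scaleR_fun_def fun_eq_iff scaleR_add_right scaleR_add_left)

end

text \<open>A function on \<open>\<Gamma>\<close> is represented by its extension by \<open>0\<close> to the whole type.\<close>

definition c0_space :: "'i set \<Rightarrow> ('i \<Rightarrow> real) set" where
  "c0_space \<Gamma> =
     {f. (\<forall>i. i \<notin> \<Gamma> \<longrightarrow> f i = 0) \<and> (\<forall>\<epsilon>>0. finite {i \<in> \<Gamma>. \<bar>f i\<bar> \<ge> \<epsilon>})}"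

definition c0_norm :: "'i set \<Rightarrow> ('i \<Rightarrow> real) \<Rightarrow> real" where
  "c0_norm \<Gamma> f = (SUP i\<in>\<Gamma>. \<bar>f i\<bar>)"

definition lp_space :: "real \<Rightarrow> 'i set \<Rightarrow> ('i \<Rightarrow> real) set" where
  "lp_space p \<Gamma> =
     {f. (\<forall>i. i \<notin> \<Gamma> \<longrightarrow> f i = 0) \<and> (\<lambda>i. \<bar>f i\<bar> powr p) summable_on \<Gamma>}"

definition lp_norm :: "real \<Rightarrow> 'i set \<Rightarrow> ('i \<Rightarrow> real) \<Rightarrow> real" where
  "lp_norm p \<Gamma> f = (\<Sum>\<^sub>\<infinity>i\<in>\<Gamma>. \<bar>f i\<bar> powr p) powr (1 / p)"

end

theory Submission
  imports Defs
begin

text \<open>Restriction to the unit vectors identifies the dual ball of \<open>c\<^sub>0(\<Gamma>)\<close> and of \<open>\<ell>\<^sub>p(\<Gamma>)\<close> with the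
  pointwise compact set \<open>K\<close> of all \<open>x\<close> on \<open>\<Gamma>\<close> with \<open>\<Sum>\<bar>x i\<bar>\<^sup>q \<le> 1\<close>, where \<open>q = 1\<close> for
  \<open>c\<^sub>0(\<Gamma>)\<close> and \<open>q\<close> is the conjugate exponent of \<open>p\<close> for \<open>\<ell>\<^sub>p(\<Gamma>)\<close>. A continuous map from \<open>K\<close>
  onto a space of countable weight depends on countably many coordinates, so the restrictions
  \<open>K \<rightarrow> \<real>\<^sup>A\<close>, \<open>A\<close> countable, form a cofinal \<open>\<sigma>\<close>-semilattice, and any other one contains such
  restrictions with \<open>A\<close> arbitrarily large.

  If the norms of a weak\<open>\<^sup>*\<close> convergent sequence \<open>x\<^sub>n \<rightarrow> x\<close> converge to the norm of \<open>x\<close>, then a point \<open>y\<close>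
  with \<open>y = x\<close> on \<open>A\<close> is the limit of points equal to \<open>x\<^sub>n\<close> on \<open>A\<close> and to \<open>t\<^sub>n y\<close> off
  \<open>A\<close>, with \<open>t\<^sub>n \<rightarrow> 1\<close> chosen so as to stay in the ball. Conversely, if \<open>A\<close> contains all supports and
  \<open>i \<notin> A\<close>, lifting the sequence to the point \<open>x + c e\<^sub>i\<close> of norm one shows
  \<open>limsup \<parallel>x\<^sub>n\<parallel>\<^sup>q \<le> 1 - c\<^sup>q = \<parallel>x\<parallel>\<^sup>q\<close>. In \<open>\<ell>\<^sub>q\<close>, weak\<open>\<^sup>*\<close> convergence with convergence of the norms is
  norm convergence.\<close>

section \<open>Quotients of compact spaces with separating coordinates\<close>

text \<open>Finite intersections of members of \<open>\<O>\<close> form a base. Given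
  \<open>x\<close> in an open \<open>U\<close>, the compact complement of \<open>U\<close> is
  covered by members of \<open>\<O>\<close> that have a disjoint partner in \<open>\<O>\<close>
  containing \<open>x\<close>; intersecting the partners of a finite subcover gives a basic set
  inside \<open>U\<close>.\<close>

lemma countable_weightI_compact:
  assumes X: "compact_space X" and "countable \<O>" and op: "\<And>U. U \<in> \<O> \<Longrightarrow> openin X U"
    and sep: "\<And>x y. \<lbrakk>x \<in> topspace X; y \<in> topspace X; x \<noteq> y\<rbrakk> \<Longrightarrow>
                 \<exists>U\<in>\<O>. \<exists>V\<in>\<O>. x \<in> U \<and> y \<in> V \<and> U \<inter> V = {}"
  shows "countable_weight X"
proof -
  \<comment> \<open>Inserting \<open>topspace X\<close> makes the intersection over the empty family
    the whole space instead of the whole type.\<close>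
  define \<B> where "\<B> = (\<lambda>F. \<Inter>(insert (topspace X) F)) ` {F. finite F \<and> F \<subseteq> \<O>}"
  have "countable {F. finite F \<and> F \<subseteq> \<O>}"
    using countable_Collect_finite_subset[OF \<open>countable \<O>\<close>] by (simp add: conj_commute)
  then have "countable \<B>" by (simp add: \<B>_def)
  moreover have "openin X B" if "B \<in> \<B>" for B
    using that op unfolding \<B>_def
    by (auto intro!: openin_Int_Inter)
  moreover have "\<exists>B\<in>\<B>. x \<in> B \<and> B \<subseteq> U" if U: "openin X U" and x: "x \<in> U" for U x
  proof -
    have xX: "x \<in> topspace X" using U x openin_subset by blast
    define \<V> where "\<V> = {V\<in>\<O>. \<exists>U\<in>\<O>. x \<in> U \<and> U \<inter> V = {}}"
    have "compactin X (topspace X - U)"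
      using X U by (simp add: closedin_compact_space closedin_diff)
    moreover have "topspace X - U \<subseteq> \<Union>\<V>"
    proof
      fix y assume "y \<in> topspace X - U"
      then obtain U' V' where "U' \<in> \<O>" "V' \<in> \<O>" "x \<in> U'" "y \<in> V'" "U' \<inter> V' = {}"
        using sep[OF xX, of y] x by blast
      then show "y \<in> \<Union>\<V>" unfolding \<V>_def by blast
    qed
    ultimately obtain \<F> where F: "finite \<F>" "\<F> \<subseteq> \<V>" "topspace X - U \<subseteq> \<Union>\<F>"
      unfolding compactin_def by (metis (no_types, lifting) \<V>_def mem_Collect_eq op)
    have "\<forall>V\<in>\<F>. \<exists>U'. U' \<in> \<O> \<and> x \<in> U' \<and> U' \<inter> V = {}"
      using F(2) unfolding \<V>_def by blast
    then obtain u where u: "\<And>V. V \<in> \<F> \<Longrightarrow> u V \<in> \<O> \<and> x \<in> u V \<and> u V \<inter> V = {}"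
      by metis
    let ?B = "\<Inter>(insert (topspace X) (u ` \<F>))"
    have "?B \<in> \<B>" unfolding \<B>_def using F(1) u by (intro imageI) auto
    moreover have "x \<in> ?B" using u xX by auto
    moreover have "?B \<subseteq> U"
    proof
      fix z assume z: "z \<in> ?B"
      show "z \<in> U"
      proof (rule ccontr)
        assume "z \<notin> U"
        then obtain V where "V \<in> \<F>" "z \<in> V" using F(3) z by auto
        then show False using u[of V] z by blast
      qed
    qed
    ultimately show ?thesis by blast
  qed
  ultimately show ?thesis unfolding countable_weight_def by blast
qed

section \<open>Maps out of a quotient and the order of quotients\<close>

lemma continuous_map_quotient_projection:
  "continuous_map K (quotient_space K E) (\<lambda>x. E `` {x})"
  by (auto simp: continuous_map_def topspace_quotient_space openin_quotient_space
      intro: quotientI)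

lemma compact_space_quotient_space:
  assumes "compact_space K"
  shows "compact_space (quotient_space K E)"
proof -
  have "(\<lambda>x. E `` {x}) ` topspace K = topspace (quotient_space K E)"
    unfolding topspace_quotient_space quotient_def by blast
  then show ?thesis
    using image_compactin[OF _ continuous_map_quotient_projection, of K "topspace K" E] assms
    by (simp add: compact_space_def)
qed

text \<open>Universal property of the quotient. It supplies both the natural projections between
  quotients and the coordinate functions on a quotient.\<close>

lemma continuous_map_from_quotient_space:
  assumes f: "continuous_map K Y f" and E: "equiv (topspace K) E"
    and inv: "\<And>x y. (x, y) \<in> E \<Longrightarrow> f x = f y"
  shows "\<exists>g. continuous_map (quotient_space K E) Y g \<and> (\<forall>x\<in>topspace K. g (E `` {x}) = f x)"
proof -
  define g where "g C = f (SOME x. x \<in> C)" for C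
  have g: "g (E `` {x}) = f x" if "x \<in> topspace K" for x
  proof -
    have "x \<in> E `` {x}" using E that by (rule equiv_class_self)
    then have "(SOME y. y \<in> E `` {x}) \<in> E `` {x}" by (rule someI)
    then show ?thesis unfolding g_def using inv by fastforce
  qed
  moreover have "continuous_map (quotient_space K E) Y g"
    unfolding continuous_map_def
  proof (intro conjI allI impI)
    show "g \<in> topspace (quotient_space K E) \<rightarrow> topspace Y"
      using continuous_map_image_subset_topspace[OF f] g
      by (auto simp: topspace_quotient_space elim!: quotientE)
  next
    fix U assume "openin Y U"
    then have "openin K {x \<in> topspace K. f x \<in> U}"
      using f by (simp add: continuous_map_def)
    moreover have "{x \<in> topspace K. E `` {x} \<in> {C \<in> topspace K // E. g C \<in> U}} =
        {x \<in> topspace K. f x \<in> U}"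
      using g by (auto intro: quotientI)
    ultimately show "openin (quotient_space K E) {C \<in> topspace (quotient_space K E). g C \<in> U}"
      by (simp add: openin_quotient_space topspace_quotient_space)
  qed
  ultimately show ?thesis by (intro exI[of _ g]) simp
qed

text \<open>A natural projection sends equal \<open>E'\<close>-classes to equal
  \<open>E\<close>-classes, which forces the inclusion. Conversely, under the inclusion the map to
  \<open>E\<close>-classes is constant on \<open>E'\<close>-classes and descends.\<close>

lemma quotient_le_iff:
  assumes "equiv (topspace K) E" "equiv (topspace K) E'"
  shows "quotient_le K E E' \<longleftrightarrow> E' \<subseteq> E"
proof
  assume "quotient_le K E E'"
  then obtain q where q: "\<forall>x\<in>topspace K. q (E' `` {x}) = E `` {x}"
    unfolding quotient_le_def natural_projection_def by (elim exE conjE)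
  show "E' \<subseteq> E"
  proof clarify
    fix x y assume xy: "(x, y) \<in> E'"
    then have "x \<in> topspace K" "y \<in> topspace K"
      using assms(2) by (auto simp: equiv_def refl_on_def)
    moreover have "E' `` {x} = E' `` {y}" using xy assms(2) by (simp add: equiv_class_eq_iff)
    ultimately have "E `` {x} = E `` {y}" using q by metis
    then show "(x, y) \<in> E"
      using assms(1) \<open>x \<in> topspace K\<close> \<open>y \<in> topspace K\<close> by (simp add: eq_equiv_class)
  qed
next
  assume sub: "E' \<subseteq> E"
  have inv: "E `` {x} = E `` {y}" if "(x, y) \<in> E'" for x y
    using that sub assms(1) by (auto intro!: equiv_class_eq)
  have "\<exists>q. continuous_map (quotient_space K E') (quotient_space K E) q \<and>
      (\<forall>x\<in>topspace K. q (E' `` {x}) = E `` {x})"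
    by (rule continuous_map_from_quotient_space[OF continuous_map_quotient_projection assms(2)])
       (rule inv)
  then obtain q where q: "continuous_map (quotient_space K E') (quotient_space K E) q"
    and qx: "\<forall>x\<in>topspace K. q (E' `` {x}) = E `` {x}" by (elim exE conjE)
  have "q ` (topspace K // E') = topspace K // E"
    unfolding quotient_def using qx by force
  then show "quotient_le K E E'"
    unfolding quotient_le_def natural_projection_def topspace_quotient_space using q qx by blast
qed

text \<open>Such coordinates embed \<open>K\<close> into a power of the real line. The dual ball is
  the intended instance, with evaluation at the unit vectors as coordinates.\<close>

locale compact_coordinates =
  fixes K :: "'a topology" and \<Gamma> :: "'i set" and h :: "'i \<Rightarrow> 'a \<Rightarrow> real"
  assumes compact: "compact_space K"
    and continuous: "\<And>i. i \<in> \<Gamma> \<Longrightarrow> continuous_map K euclideanreal (h i)"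
    and separating: "\<And>x y. \<lbrakk>x \<in> topspace K; y \<in> topspace K; \<And>i. i \<in> \<Gamma> \<Longrightarrow> h i x = h i y\<rbrakk> \<Longrightarrow> x = y"
begin

text \<open>For \<open>A \<subseteq> \<Gamma>\<close> the quotient by this relation is the image of
  \<open>K\<close> under restriction to the coordinates in \<open>A\<close>.\<close>

definition agree :: "'i set \<Rightarrow> ('a \<times> 'a) set" where
  "agree A = {(x, y). x \<in> topspace K \<and> y \<in> topspace K \<and> (\<forall>i\<in>A. h i x = h i y)}"

lemma equiv_agree: "equiv (topspace K) (agree A)"
  by (intro equivI) (auto simp: agree_def refl_on_def sym_def trans_def)

lemma agree_class_eq_iff:
  assumes "x \<in> topspace K" "y \<in> topspace K"
  shows "agree A `` {x} = agree A `` {y} \<longleftrightarrow> (\<forall>i\<in>A. h i x = h i y)"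
  using eq_equiv_class_iff[OF equiv_agree[of A] assms] assms by (simp add: agree_def)

lemma coordinate_on_quotient:
  assumes "i \<in> A" "A \<subseteq> \<Gamma>"
  shows "\<exists>g. continuous_map (quotient_space K (agree A)) euclideanreal g \<and>
    (\<forall>x\<in>topspace K. g (agree A `` {x}) = h i x)"
proof -
  have "h i x = h i y" if "(x, y) \<in> agree A" for x y
    using that assms(1) by (simp add: agree_def)
  moreover have "continuous_map K euclideanreal (h i)" using assms by (intro continuous) auto
  ultimately show ?thesis
    by (intro continuous_map_from_quotient_space equiv_agree)
qed

lemma Hausdorff_space: "Hausdorff_space K"
  unfolding Hausdorff_space_def
proof clarify
  fix x y assume "x \<in> topspace K" "y \<in> topspace K" "x \<noteq> y"
  then obtain i where i: "i \<in> \<Gamma>" "h i x \<noteq> h i y" using separating by blast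
  from hausdorff[OF i(2)] obtain U V
    where UV: "open U" "open V" "h i x \<in> U" "h i y \<in> V" "U \<inter> V = {}" by (elim exE conjE)
  have op: "openin K {z \<in> topspace K. h i z \<in> W}" if "open W" for W
    by (rule openin_continuous_map_preimage[OF continuous[OF i(1)]]) (simp add: that)
  show "\<exists>U V. openin K U \<and> openin K V \<and> x \<in> U \<and> y \<in> V \<and> disjnt U V"
  proof (intro exI conjI)
    show "openin K {z \<in> topspace K. h i z \<in> U}" "openin K {z \<in> topspace K. h i z \<in> V}"
      using op UV by simp_all
    show "disjnt {z \<in> topspace K. h i z \<in> U} {z \<in> topspace K. h i z \<in> V}"
      using UV(5) by (auto simp: disjnt_iff)
  qed (use UV \<open>x \<in> topspace K\<close> \<open>y \<in> topspace K\<close> in simp_all)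
qed

text \<open>The coordinates in \<open>A\<close> descend to the quotient and separate its points.
  Their preimages of half-lines with rational endpoints are a countable separating family, which
  gives the Hausdorff property and, by compactness, countable weight.\<close>

lemma agree_in_Quotients_omega:
  assumes A: "A \<subseteq> \<Gamma>" "countable A"
  shows "agree A \<in> Quotients_omega K"
proof -
  let ?Q = "quotient_space K (agree A)"
  have "\<forall>i\<in>A. \<exists>g. continuous_map ?Q euclideanreal g \<and>
      (\<forall>x\<in>topspace K. g (agree A `` {x}) = h i x)"
    using coordinate_on_quotient[OF _ A(1)] by (rule ballI)
  from bchoice[OF this] obtain g where
    "\<forall>i\<in>A. continuous_map ?Q euclideanreal (g i) \<and>
      (\<forall>x\<in>topspace K. g i (agree A `` {x}) = h i x)" by (elim exE)
  then have g: "\<And>i. i \<in> A \<Longrightarrow> continuous_map ?Q euclideanreal (g i)"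
    and gx: "\<And>i x. i \<in> A \<Longrightarrow> x \<in> topspace K \<Longrightarrow> g i (agree A `` {x}) = h i x"
    by simp_all
  define \<O> where "\<O> = (\<lambda>(i, r). {c \<in> topspace ?Q. g i c < r}) ` (A \<times> \<rat>) \<union>
     (\<lambda>(i, r). {c \<in> topspace ?Q. g i c > r}) ` (A \<times> \<rat>)"
  have "countable \<O>" unfolding \<O>_def using A(2) countable_rat by auto
  have op: "openin ?Q U" if "U \<in> \<O>" for U
  proof -
    have "openin ?Q {c \<in> topspace ?Q. g i c \<in> {..<r}}"
      "openin ?Q {c \<in> topspace ?Q. g i c \<in> {r<..}}" if "i \<in> A" for i r
      by (intro openin_continuous_map_preimage[OF g[OF that]]; simp)+
    then show ?thesis using that unfolding \<O>_def by auto
  qed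
  have sep: "\<exists>U\<in>\<O>. \<exists>V\<in>\<O>. c \<in> U \<and> d \<in> V \<and> U \<inter> V = {}"
    if c: "c \<in> topspace ?Q" and d: "d \<in> topspace ?Q" and "c \<noteq> d" for c d
  proof -
    obtain x y where x: "x \<in> topspace K" "c = agree A `` {x}"
      and y: "y \<in> topspace K" "d = agree A `` {y}"
      using c d unfolding topspace_quotient_space by (auto elim!: quotientE)
    then obtain i where i: "i \<in> A" "g i c \<noteq> g i d"
      using \<open>c \<noteq> d\<close> agree_class_eq_iff[of x y A] gx by auto
    have *: "\<exists>U\<in>\<O>. \<exists>V\<in>\<O>. c \<in> U \<and> d \<in> V \<and> U \<inter> V = {}"
      if c: "c \<in> topspace ?Q" and d: "d \<in> topspace ?Q" and lt: "g i c < g i d" for c d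
    proof -
      obtain r where r: "r \<in> \<rat>" "g i c < r" "r < g i d" using Rats_dense_in_real[OF lt] by blast
      have "{c \<in> topspace ?Q. g i c < r} \<in> \<O>" "{c \<in> topspace ?Q. g i c > r} \<in> \<O>"
        unfolding \<O>_def using i(1) r(1) by force+
      then show ?thesis
        by (intro bexI[of _ "{c \<in> topspace ?Q. g i c < r}" \<O>]
            bexI[of _ "{c \<in> topspace ?Q. g i c > r}" \<O>] conjI) (use c d r in auto)
    qed
    show ?thesis
    proof (cases "g i c < g i d")
      case True
      then show ?thesis using *[OF c d] by blast
    next
      case False
      then have "g i d < g i c" using i by simp
      then show ?thesis using *[OF d c] by blast
    qed
  qed
  have "Hausdorff_space ?Q"
    unfolding Hausdorff_space_def disjnt_def using sep op by metis
  moreover have "countable_weight ?Q"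
    using countable_weightI_compact[OF compact_space_quotient_space[OF compact] \<open>countable \<O>\<close>] op sep
    by blast
  ultimately show ?thesis
    by (simp add: Quotients_omega_def Quotients_def equiv_agree)
qed

text \<open>The compact set \<open>C \<times> D\<close> is covered by the open sets of pairs that
  differ in a given coordinate; a finite subcover names the coordinates.\<close>

lemma finite_coordinates_separate:
  assumes C: "compactin K C" and D: "compactin K D" and "C \<inter> D = {}"
  obtains F where "finite F" "F \<subseteq> \<Gamma>"
    and "\<And>x y. \<lbrakk>x \<in> C; y \<in> D\<rbrakk> \<Longrightarrow> \<exists>i\<in>F. h i x \<noteq> h i y"
proof -
  define W where "W i = {z \<in> topspace (prod_topology K K). h i (fst z) \<noteq> h i (snd z)}" for i
  have W: "openin (prod_topology K K) (W i)" if "i \<in> \<Gamma>" for i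
  proof -
    have "continuous_map (prod_topology K K) euclideanreal (\<lambda>z. h i (fst z) - h i (snd z))"
      using continuous_map_compose[OF continuous_map_fst continuous[OF that], of K]
        continuous_map_compose[OF continuous_map_snd continuous[OF that], of K]
      by (intro continuous_intros) (auto simp: o_def)
    then have "openin (prod_topology K K)
        {z \<in> topspace (prod_topology K K). h i (fst z) - h i (snd z) \<in> - {0}}"
      by (rule openin_continuous_map_preimage) auto
    then show ?thesis by (simp add: W_def)
  qed
  have sub: "C \<subseteq> topspace K" "D \<subseteq> topspace K" using C D compactin_subset_topspace by blast+
  have "compactin (prod_topology K K) (C \<times> D)" using C D by (simp add: compactin_Times)
  moreover have "C \<times> D \<subseteq> \<Union>(W ` \<Gamma>)"
  proof clarify
    fix x y assume "x \<in> C" "y \<in> D"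
    moreover then obtain i where "i \<in> \<Gamma>" "h i x \<noteq> h i y"
      using separating[of x y] sub \<open>C \<inter> D = {}\<close> by blast
    ultimately show "(x, y) \<in> \<Union>(W ` \<Gamma>)" using sub by (auto simp: W_def)
  qed
  ultimately obtain \<F> where \<F>: "finite \<F>" "\<F> \<subseteq> W ` \<Gamma>" "C \<times> D \<subseteq> \<Union>\<F>"
    unfolding compactin_def using W by (metis (no_types, lifting) imageE)
  obtain F where "F \<subseteq> \<Gamma>" "finite F" "\<F> = W ` F"
    using finite_subset_image[OF \<F>(1,2)] by blast
  then show ?thesis
    using \<F>(3) by (intro that[of F]) (fastforce simp: W_def)+
qed

text \<open>Take all pairs of basic sets of \<open>L\<close> with disjoint closures. The preimages
  of the two closures are disjoint compact sets, separated by finitely many coordinates, and the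
  union of these finite sets over the countably many pairs is \<open>A\<close>.\<close>

lemma map_depends_on_countably_many_coordinates:
  assumes p: "continuous_map K L p" "p ` topspace K = topspace L"
    and L: "Hausdorff_space L" "countable_weight L"
  obtains A where "countable A" "A \<subseteq> \<Gamma>"
    and "\<And>x y. (x, y) \<in> agree A \<Longrightarrow> p x = p y"
proof -
  have "compact_space L"
    using image_compactin[OF _ p(1), of "topspace K"] p(2) compact by (simp add: compact_space_def)
  then have reg: "regular_space L" using L(1) compact_Hausdorff_imp_regular_space by blast
  obtain \<B> where \<B>: "countable \<B>" "\<And>V. V \<in> \<B> \<Longrightarrow> openin L V"
    "\<And>U x. openin L U \<Longrightarrow> x \<in> U \<Longrightarrow> \<exists>V\<in>\<B>. x \<in> V \<and> V \<subseteq> U"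
    using L(2) unfolding countable_weight_def by metis
  define P where "P V = {x \<in> topspace K. p x \<in> L closure_of V}" for V
  have P: "compactin K (P V)" for V
    unfolding P_def using closedin_continuous_map_preimage[OF p(1) closedin_closure_of] compact
    by (simp add: closedin_compact_space)
  define D where "D = {(U, V) \<in> \<B> \<times> \<B>. L closure_of U \<inter> L closure_of V = {}}"
  have "\<exists>F. finite F \<and> F \<subseteq> \<Gamma> \<and> (\<forall>x\<in>P (fst d). \<forall>y\<in>P (snd d). \<exists>i\<in>F. h i x \<noteq> h i y)"
    if "d \<in> D" for d
  proof -
    have "P (fst d) \<inter> P (snd d) = {}" using that by (auto simp: P_def D_def)
    from finite_coordinates_separate[OF P P this] show ?thesis by metis
  qed
  then obtain F where F: "\<And>d. d \<in> D \<Longrightarrow> finite (F d)" "\<And>d. d \<in> D \<Longrightarrow> F d \<subseteq> \<Gamma>"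
    "\<And>d x y. d \<in> D \<Longrightarrow> x \<in> P (fst d) \<Longrightarrow> y \<in> P (snd d) \<Longrightarrow> \<exists>i\<in>F d. h i x \<noteq> h i y"
    by metis
  have "countable D"
    unfolding D_def by (rule countable_subset[of _ "\<B> \<times> \<B>"]) (use \<B>(1) in auto)
  then have "countable (\<Union>(F ` D))" using F(1) by (intro countable_UN) (auto intro: countable_finite)
  moreover have "\<Union>(F ` D) \<subseteq> \<Gamma>" using F(2) by blast
  moreover have "p x = p y" if xy: "(x, y) \<in> agree (\<Union>(F ` D))" for x y
  proof (rule ccontr)
    assume ne: "p x \<noteq> p y"
    have xyK: "x \<in> topspace K" "y \<in> topspace K" using xy by (auto simp: agree_def)
    then have pL: "p x \<in> topspace L" "p y \<in> topspace L" using p(2) by auto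
    then obtain U V where UV: "openin L U" "openin L V" "p x \<in> U" "p y \<in> V" "disjnt U V"
      using L(1) ne unfolding Hausdorff_space_def by blast
    \<comment> \<open>Regularity of \<open>L\<close> yields basic neighbourhoods with small closure,
      so two distinct values of \<open>p\<close> always fall into some pair in
      \<open>D\<close>.\<close>
    have shrink: "\<exists>B\<in>\<B>. z \<in> B \<and> L closure_of B \<subseteq> U" if U: "openin L U" "z \<in> U" for U z
    proof -
      have "\<forall>W x. openin L W \<and> x \<in> W \<longrightarrow>
          (\<exists>U' C. openin L U' \<and> closedin L C \<and> x \<in> U' \<and> U' \<subseteq> C \<and> C \<subseteq> W)"
        using neighbourhood_base_of_closedin[THEN iffD2, OF reg] unfolding neighbourhood_base_of .
      then obtain U' C where "openin L U'" "closedin L C" "z \<in> U'" "U' \<subseteq> C" "C \<subseteq> U"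
        using U by meson
      moreover then obtain B where "B \<in> \<B>" "z \<in> B" "B \<subseteq> U'" using \<B>(3) by blast
      ultimately show ?thesis by (meson closure_of_minimal subset_trans)
    qed
    obtain B B' where B: "B \<in> \<B>" "p x \<in> B" "L closure_of B \<subseteq> U"
      and B': "B' \<in> \<B>" "p y \<in> B'" "L closure_of B' \<subseteq> V"
      using shrink UV by meson
    have "(B, B') \<in> D" using B B' UV(5) by (auto simp: D_def disjnt_def)
    moreover have "x \<in> P B" "y \<in> P B'"
      using B B' xyK pL closure_of_subset[OF openin_subset[OF \<B>(2)]] by (auto simp: P_def)
    ultimately obtain i where "i \<in> F (B, B')" "h i x \<noteq> h i y" using F(3)[of "(B, B')" x y] by auto
    then show False using xy \<open>(B, B') \<in> D\<close> by (auto simp: agree_def)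
  qed
  ultimately show ?thesis by (rule that)
qed

lemma Quotients_omega_contains_agree:
  assumes "E \<in> Quotients_omega K"
  obtains A where "countable A" "A \<subseteq> \<Gamma>" "agree A \<subseteq> E"
proof -
  have E: "equiv (topspace K) E" "Hausdorff_space (quotient_space K E)"
    "countable_weight (quotient_space K E)"
    using assms by (auto simp: Quotients_omega_def Quotients_def)
  have "(\<lambda>x. E `` {x}) ` topspace K = topspace (quotient_space K E)"
    unfolding topspace_quotient_space quotient_def by blast
  from map_depends_on_countably_many_coordinates[OF continuous_map_quotient_projection this E(2,3)]
  obtain A where A: "countable A" "A \<subseteq> \<Gamma>"
    "\<And>x y. (x, y) \<in> agree A \<Longrightarrow> E `` {x} = E `` {y}" by blast
  have "agree A \<subseteq> E"
  proof clarify
    fix x y assume xy: "(x, y) \<in> agree A"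
    then show "(x, y) \<in> E"
      using A(3)[OF xy] eq_equiv_class[OF _ E(1), of x y] by (auto simp: agree_def)
  qed
  with A that show ?thesis by blast
qed

text \<open>If \<open>K\<close> had countable weight, the identity map of \<open>K\<close> would
  depend on countably many coordinates.\<close>

lemma not_countable_weightI:
  assumes "\<And>A. \<lbrakk>countable A; A \<subseteq> \<Gamma>\<rbrakk> \<Longrightarrow> \<exists>x y. (x, y) \<in> agree A \<and> x \<noteq> y"
  shows "\<not> countable_weight K"
proof
  assume "countable_weight K"
  obtain A where A: "countable A" "A \<subseteq> \<Gamma>"
    and eq: "\<And>x y. (x, y) \<in> agree A \<Longrightarrow> id x = id y"
    by (rule map_depends_on_countably_many_coordinates
        [OF continuous_map_id _ Hausdorff_space \<open>countable_weight K\<close>]) auto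
  obtain x y where "(x, y) \<in> agree A" "x \<noteq> y" using assms[OF A] by (elim exE conjE)
  with eq[of x y] show False by simp
qed

section \<open>Suprema and semilattices of coordinate restrictions\<close>

lemma agree_in_Quotients: "\<lbrakk>A \<subseteq> \<Gamma>; countable A\<rbrakk> \<Longrightarrow> agree A \<in> Quotients K"
  using agree_in_Quotients_omega[of A] by (simp add: Quotients_omega_def)

text \<open>Suprema of quotients are intersections of relations, and agreeing on every
  \<open>A\<close> in \<open>I\<close> means agreeing on the union.\<close>

lemma is_quotient_sup_agree:
  assumes "countable I" "\<And>A. A \<in> I \<Longrightarrow> countable A \<and> A \<subseteq> \<Gamma>"
  shows "is_quotient_sup K (agree ` I) (agree (\<Union>I))"
proof -
  have "countable (\<Union>I)" using assms countable_UN[of I "\<lambda>A. A"] by simp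
  then have "agree (\<Union>I) \<in> Quotients K" using assms(2) by (intro agree_in_Quotients) auto
  moreover have "quotient_le K (agree A) (agree (\<Union>I))" if "A \<in> I" for A
    unfolding quotient_le_iff[OF equiv_agree equiv_agree] using that by (auto simp: agree_def)
  moreover have "quotient_le K (agree (\<Union>I)) F"
    if F: "F \<in> Quotients K" and le: "\<And>A. A \<in> I \<Longrightarrow> quotient_le K (agree A) F" for F
  proof -
    have eF: "equiv (topspace K) F" using F by (simp add: Quotients_def)
    \<comment> \<open>Recorded separately because \<open>I\<close> may be empty, in which case no
      \<open>agree A\<close> provides it.\<close>
    then have "F \<subseteq> topspace K \<times> topspace K" by (auto simp: equiv_def refl_on_def)
    moreover have "F \<subseteq> agree A" if "A \<in> I" for A
      using le[OF that] eF by (simp add: quotient_le_iff equiv_agree)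
    ultimately have "F \<subseteq> agree (\<Union>I)" unfolding agree_def by blast
    then show ?thesis using eF by (simp add: quotient_le_iff equiv_agree)
  qed
  ultimately show ?thesis unfolding is_quotient_sup_def by blast
qed

definition countable_agree :: "('a \<times> 'a) set set" where
  "countable_agree = agree ` {A. countable A \<and> A \<subseteq> \<Gamma>}"

lemma cofinal_family_countable_agree: "cofinal_family K countable_agree"
  unfolding cofinal_family_def
proof (intro conjI ballI)
  show "countable_agree \<subseteq> Quotients_omega K"
    unfolding countable_agree_def using agree_in_Quotients_omega by blast
next
  fix E assume E: "E \<in> Quotients_omega K"
  then obtain A where A: "countable A" "A \<subseteq> \<Gamma>" "agree A \<subseteq> E"
    by (rule Quotients_omega_contains_agree)
  then have "quotient_le K E (agree A)"
    using E by (simp add: quotient_le_iff equiv_agree Quotients_omega_def Quotients_def)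
  then show "\<exists>E'\<in>countable_agree. quotient_le K E E'"
    unfolding countable_agree_def using A by blast
qed

lemma sigma_semilattice_countable_agree: "sigma_semilattice K countable_agree"
  unfolding sigma_semilattice_def
proof (intro conjI allI impI)
  show "countable_agree \<subseteq> Quotients_omega K"
    unfolding countable_agree_def using agree_in_Quotients_omega by blast
next
  fix \<A> assume "\<A> \<subseteq> countable_agree" "countable \<A>"
  then obtain I where I: "countable I" "I \<subseteq> {A. countable A \<and> A \<subseteq> \<Gamma>}" "\<A> = agree ` I"
    unfolding countable_agree_def by (meson countable_subset_image)
  have "is_quotient_sup K (agree ` I) (agree (\<Union>I))"
    by (rule is_quotient_sup_agree) (use I in auto)
  moreover have "agree (\<Union>I) \<in> countable_agree"
    unfolding countable_agree_def using I countable_UN[of I "\<lambda>A. A"] by (intro imageI) auto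
  ultimately show "\<exists>E\<in>countable_agree. is_quotient_sup K \<A> E" using I(3) by blast
qed

text \<open>Interleaving members of \<open>\<S>\<close> with relations \<open>agree A\<close> makes the two increasing sequences
  have the same supremum, which therefore lies in \<open>\<S>\<close>.\<close>

lemma sigma_semilattice_contains_agree:
  assumes cof: "cofinal_family K \<S>" and sl: "sigma_semilattice K \<S>"
    and A0: "countable A0" "A0 \<subseteq> \<Gamma>"
  obtains A where "A0 \<subseteq> A" "countable A" "A \<subseteq> \<Gamma>" "agree A \<in> \<S>"
proof -
  let ?C = "\<lambda>A. countable A \<and> A \<subseteq> \<Gamma>"
  have S: "\<S> \<subseteq> Quotients_omega K" using cof by (simp add: cofinal_family_def)
  then have eqS: "equiv (topspace K) E" if "E \<in> \<S>" for E
    using that by (auto simp: Quotients_omega_def Quotients_def)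
  \<comment> \<open>One round of the interleaving: cofinality gives a member \<open>E\<close> of
    \<open>\<S>\<close> contained in \<open>agree A\<close>, and \<open>E\<close> in turn contains
    \<open>agree A'\<close> for a larger countable \<open>A'\<close>.\<close>
  have "\<exists>A' E. ?C A' \<and> A \<subseteq> A' \<and> E \<in> \<S> \<and> agree A' \<subseteq> E \<and> E \<subseteq> agree A" if A: "?C A" for A
  proof -
    obtain E where E: "E \<in> \<S>" "quotient_le K (agree A) E"
      using cof agree_in_Quotients_omega A unfolding cofinal_family_def by blast
    obtain B where "countable B" "B \<subseteq> \<Gamma>" "agree B \<subseteq> E"
      using Quotients_omega_contains_agree[of E] E(1) S by blast
    moreover have "agree (A \<union> B) \<subseteq> agree B" by (auto simp: agree_def)
    moreover have "E \<subseteq> agree A" using E eqS by (simp add: quotient_le_iff equiv_agree)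
    ultimately show ?thesis using A E(1) by (intro exI[of _ "A \<union> B"] exI[of _ E]) auto
  qed
  then obtain nxt e where nx: "\<And>A. ?C A \<Longrightarrow> ?C (nxt A) \<and> A \<subseteq> nxt A \<and>
      e A \<in> \<S> \<and> agree (nxt A) \<subseteq> e A \<and> e A \<subseteq> agree A" by metis
  define B where "B n = (nxt ^^ n) A0" for n
  have B: "?C (B n)" for n by (induction n) (use A0 nx in \<open>auto simp: B_def\<close>)
  have Suc: "B (Suc n) = nxt (B n)" for n by (simp add: B_def)
  define A where "A = (\<Union>n. B n)"
  have A: "countable A" "A \<subseteq> \<Gamma>" unfolding A_def using B by auto
  have "range (\<lambda>n. e (B n)) \<subseteq> \<S>" using nx B by blast
  moreover have "countable (range (\<lambda>n. e (B n)))" by simp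
  ultimately obtain E where E: "E \<in> \<S>" "is_quotient_sup K (range (\<lambda>n. e (B n))) E"
    using sl unfolding sigma_semilattice_def by meson
  have eqe: "equiv (topspace K) (e (B n))" for n using eqS nx[OF B[of n]] by blast
  have "quotient_le K (e (B n)) E" for n
    using E(2) unfolding is_quotient_sup_def by blast
  then have "E \<subseteq> e (B n)" for n
    unfolding quotient_le_iff[OF eqe eqS[OF E(1)]] .
  then have "E \<subseteq> agree (B n)" for n using nx[OF B] by blast
  then have "E \<subseteq> agree A" unfolding A_def agree_def by fast
  \<comment> \<open>Since \<open>B (Suc n) \<subseteq> A\<close>, the quotient by
    \<open>agree A\<close> is an upper bound of all those by \<open>e (B n)\<close>; the least upper
    bound \<open>E\<close> lies below it.\<close>
  moreover have "agree A \<subseteq> E"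
  proof -
    have "agree A \<subseteq> e (B n)" for n
    proof -
      have "agree A \<subseteq> agree (B (Suc n))" by (auto simp: A_def agree_def)
      then show ?thesis using nx[OF B[of n]] Suc by auto
    qed
    then have "quotient_le K (e (B n)) (agree A)" for n
      unfolding quotient_le_iff[OF eqe equiv_agree] .
    then have "quotient_le K E (agree A)"
      using E(2) agree_in_Quotients[OF A(2,1)] unfolding is_quotient_sup_def by blast
    then show ?thesis using eqS[OF E(1)] by (simp add: quotient_le_iff equiv_agree)
  qed
  moreover have "A0 \<subseteq> A" unfolding A_def using B_def[of 0] by auto
  ultimately show ?thesis using that A E(1) by auto
qed

end

section \<open>Spaces dual to \<open>\<ell>\<^sub>q(\<Gamma>)\<close>\<close>

definition restrict0 :: "'i set \<Rightarrow> ('i \<Rightarrow> real) \<Rightarrow> 'i \<Rightarrow> real" where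
  "restrict0 F f = (\<lambda>i. if i \<in> F then f i else 0)"

definition unit_vec :: "'i \<Rightarrow> 'i \<Rightarrow> real" where
  "unit_vec i = (\<lambda>j. if j = i then 1 else 0)"

lemma scaleR_fun_apply [simp]: "(c *\<^sub>R f) x = c *\<^sub>R f x"
  by (simp add: scaleR_fun_def)

text \<open>\<open>\<nu> F\<close> is the norm on \<open>\<real>\<^sup>F\<close> dual to the \<open>\<ell>\<^sub>q\<close> norm: the maximum norm for \<open>q = 1\<close>, the
  \<open>\<ell>\<^sub>p\<close> norm for conjugate exponents \<open>p\<close> and \<open>q\<close>.\<close>

locale lq_dual_seminorms =
  fixes q :: real and \<nu> :: "'i set \<Rightarrow> ('i \<Rightarrow> real) \<Rightarrow> real"
  assumes q_ge_1: "1 \<le> q"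
    and hoelder: "\<And>F a f. \<lbrakk>finite F; (\<Sum>i\<in>F. \<bar>a i\<bar> powr q) \<le> 1\<rbrakk> \<Longrightarrow> (\<Sum>i\<in>F. a i * f i) \<le> \<nu> F f"
    and norming: "\<And>F f. finite F \<Longrightarrow>
      \<exists>a. (\<Sum>i\<in>F. \<bar>a i\<bar> powr q) \<le> 1 \<and> \<nu> F f = (\<Sum>i\<in>F. a i * f i)"
    and dual_norming: "\<And>F a. finite F \<Longrightarrow>
      \<exists>f. \<nu> F f \<le> 1 \<and> (\<Sum>i\<in>F. a i * f i) = (\<Sum>i\<in>F. \<bar>a i\<bar> powr q) powr (1 / q)"
begin

section \<open>Norm properties of the seminorms, by duality\<close>

lemma nu_empty [simp]: "\<nu> {} f = 0"
  using norming[of "{}" f] by simp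

lemma nu_nonneg: "finite F \<Longrightarrow> 0 \<le> \<nu> F f"
  using hoelder[of F "\<lambda>_. 0" f] by simp

text \<open>As in the estimates that follow, a vector norming the left side is tested on the right:
  restricted to \<open>G\<close> it stays in the \<open>q\<close>-ball and gives the same sum, since
  \<open>f\<close> vanishes on \<open>H - G\<close>.\<close>

lemma nu_supported:
  assumes "finite H" "G \<subseteq> H" and 0: "\<And>i. i \<in> H - G \<Longrightarrow> f i = 0"
  shows "\<nu> H f \<le> \<nu> G f"
proof -
  obtain a where a: "(\<Sum>i\<in>H. \<bar>a i\<bar> powr q) \<le> 1" "\<nu> H f = (\<Sum>i\<in>H. a i * f i)"
    using norming[OF assms(1)] by blast
  have "(\<Sum>i\<in>G. \<bar>a i\<bar> powr q) \<le> (\<Sum>i\<in>H. \<bar>a i\<bar> powr q)"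
    using assms by (intro sum_mono2) auto
  then have "(\<Sum>i\<in>G. a i * f i) \<le> \<nu> G f"
    using a(1) assms by (intro hoelder) (auto intro: finite_subset)
  moreover have "(\<Sum>i\<in>H. a i * f i) = (\<Sum>i\<in>G. a i * f i)"
    using assms by (intro sum.mono_neutral_right) auto
  ultimately show ?thesis using a(2) by simp
qed

lemma nu_mono:
  assumes "finite H" "G \<subseteq> H"
  shows "\<nu> G f \<le> \<nu> H f"
proof -
  have G: "finite G" using assms finite_subset by blast
  obtain a where a: "(\<Sum>i\<in>G. \<bar>a i\<bar> powr q) \<le> 1" "\<nu> G f = (\<Sum>i\<in>G. a i * f i)"
    using norming[OF G] by blast
  let ?b = "\<lambda>i. if i \<in> G then a i else 0"
  have "(\<Sum>i\<in>H. \<bar>?b i\<bar> powr q) = (\<Sum>i\<in>G. \<bar>a i\<bar> powr q)"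
    using assms by (intro sum.mono_neutral_cong_right) auto
  then have "(\<Sum>i\<in>H. ?b i * f i) \<le> \<nu> H f" using a(1) assms by (intro hoelder) auto
  moreover have "(\<Sum>i\<in>H. ?b i * f i) = (\<Sum>i\<in>G. a i * f i)"
    using assms by (intro sum.mono_neutral_cong_right) auto
  ultimately show ?thesis using a(2) by simp
qed

lemma nu_le_add:
  assumes F: "finite F" and "\<And>i. i \<in> F \<Longrightarrow> f i = g i + h i"
  shows "\<nu> F f \<le> \<nu> F g + \<nu> F h"
proof -
  obtain a where a: "(\<Sum>i\<in>F. \<bar>a i\<bar> powr q) \<le> 1" "\<nu> F f = (\<Sum>i\<in>F. a i * f i)"
    using norming[OF F] by blast
  have "(\<Sum>i\<in>F. a i * f i) = (\<Sum>i\<in>F. a i * g i) + (\<Sum>i\<in>F. a i * h i)"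
    unfolding sum.distrib[symmetric] using assms by (intro sum.cong) (auto simp: algebra_simps)
  then show ?thesis using hoelder[OF F a(1), of g] hoelder[OF F a(1), of h] a(2) by linarith
qed

lemma nu_scale_le:
  assumes F: "finite F" and f: "\<And>i. i \<in> F \<Longrightarrow> f i = c * g i"
  shows "\<nu> F f \<le> \<bar>c\<bar> * \<nu> F g"
proof -
  obtain a where a: "(\<Sum>i\<in>F. \<bar>a i\<bar> powr q) \<le> 1" "\<nu> F f = (\<Sum>i\<in>F. a i * f i)"
    using norming[OF F] by blast
  \<comment> \<open>The sign of \<open>c\<close> is moved into the norming vector. For
    \<open>c = 0\<close> this vector vanishes, so its \<open>q\<close>-sum is bounded by that of
    \<open>a\<close> but need not equal it.\<close>
  let ?b = "\<lambda>i. sgn c * a i"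
  have "(\<Sum>i\<in>F. \<bar>?b i\<bar> powr q) \<le> (\<Sum>i\<in>F. \<bar>a i\<bar> powr q)"
    by (intro sum_mono) (auto simp: abs_mult sgn_if)
  then have "(\<Sum>i\<in>F. ?b i * g i) \<le> \<nu> F g" using a(1) F by (intro hoelder) auto
  then have "\<bar>c\<bar> * (\<Sum>i\<in>F. ?b i * g i) \<le> \<bar>c\<bar> * \<nu> F g" by (intro mult_left_mono) auto
  moreover have "\<bar>c\<bar> * (\<Sum>i\<in>F. ?b i * g i) = (\<Sum>i\<in>F. a i * f i)"
    unfolding sum_distrib_left using f by (intro sum.cong) (auto simp: sgn_if)
  ultimately show ?thesis using a(2) by simp
qed

lemma nu_cong:
  assumes F: "finite F" and f: "\<And>i. i \<in> F \<Longrightarrow> f i = g i"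
  shows "\<nu> F f = \<nu> F g"
  using nu_scale_le[OF F, of f 1 g] nu_scale_le[OF F, of g 1 f] f by simp

lemma abs_le_nu:
  assumes F: "finite F" and i: "i \<in> F"
  shows "\<bar>f i\<bar> \<le> \<nu> F f"
proof -
  let ?a = "\<lambda>j. if j = i then sgn (f i) else 0"
  have "(\<Sum>j\<in>F. \<bar>?a j\<bar> powr q) = (\<Sum>j\<in>{i}. \<bar>?a j\<bar> powr q)"
    using assms by (intro sum.mono_neutral_right) auto
  then have "(\<Sum>j\<in>F. ?a j * f j) \<le> \<nu> F f" using F by (intro hoelder) (auto simp: sgn_if)
  moreover have "(\<Sum>j\<in>F. ?a j * f j) = (\<Sum>j\<in>{i}. ?a j * f j)"
    using assms by (intro sum.mono_neutral_right) auto
  ultimately show ?thesis by (simp add: sgn_if split: if_splits)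
qed

text \<open>The entries of a norming vector have absolute value at most 1. This crude bound is
  enough to control \<nu> on a fixed finite set under pointwise convergence.\<close>

lemma nu_le_sum: "finite F \<Longrightarrow> \<nu> F f \<le> (\<Sum>i\<in>F. \<bar>f i\<bar>)"
proof -
  assume F: "finite F"
  obtain a where a: "(\<Sum>i\<in>F. \<bar>a i\<bar> powr q) \<le> 1" "\<nu> F f = (\<Sum>i\<in>F. a i * f i)"
    using norming[OF F] by blast
  have "a i * f i \<le> \<bar>f i\<bar>" if "i \<in> F" for i
  proof -
    have "\<bar>a i\<bar> powr q \<le> (\<Sum>i\<in>F. \<bar>a i\<bar> powr q)"
      using F that by (intro member_le_sum) auto
    then have "\<bar>a i\<bar> powr q \<le> 1" using a by simp
    then have "\<bar>a i\<bar> \<le> 1"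
      using gr_one_powr[of "\<bar>a i\<bar>" q] q_ge_1 by linarith
    then have "\<bar>a i\<bar> * \<bar>f i\<bar> \<le> 1 * \<bar>f i\<bar>" by (intro mult_right_mono) auto
    then show ?thesis using abs_ge_self[of "a i * f i"] by (simp add: abs_mult)
  qed
  then show ?thesis unfolding a(2) by (intro sum_mono)
qed

text \<open>Homogeneous form of \<open>hoelder\<close>: divide \<open>a\<close> by \<open>c\<close>
  and adjust the signs of its entries so that every term becomes an absolute value. For
  \<open>c = 0\<close> all entries on \<open>F\<close> vanish.\<close>

lemma hoelder_general:
  assumes F: "finite F" and c: "0 \<le> c" and a: "(\<Sum>i\<in>F. \<bar>a i\<bar> powr q) \<le> c powr q"
  shows "(\<Sum>i\<in>F. \<bar>a i * f i\<bar>) \<le> c * \<nu> F f"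
proof (cases "c = 0")
  case True
  have "a i = 0" if "i \<in> F" for i
  proof -
    have "\<bar>a i\<bar> powr q \<le> (\<Sum>i\<in>F. \<bar>a i\<bar> powr q)"
      using that F by (intro member_le_sum) auto
    also have "\<dots> \<le> 0" using a True by simp
    finally have "\<bar>a i\<bar> powr q = 0" by (intro order_antisym) auto
    then show ?thesis by simp
  qed
  then show ?thesis using True by simp
next
  case False
  with c have c: "c > 0" by simp
  let ?b = "\<lambda>i. sgn (a i * f i) * a i / c"
  have "\<bar>?b i\<bar> powr q \<le> \<bar>a i\<bar> powr q / c powr q" for i
    using c by (auto simp: abs_mult sgn_if powr_divide)
  then have "(\<Sum>i\<in>F. \<bar>?b i\<bar> powr q) \<le> (\<Sum>i\<in>F. \<bar>a i\<bar> powr q / c powr q)" by (intro sum_mono)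
  also have "\<dots> = (\<Sum>i\<in>F. \<bar>a i\<bar> powr q) / c powr q" by (simp add: sum_divide_distrib)
  also have "\<dots> \<le> 1" using a c by (simp add: divide_le_eq)
  finally have "(\<Sum>i\<in>F. ?b i * f i) \<le> \<nu> F f" using F by (intro hoelder)
  then have "c * (\<Sum>i\<in>F. ?b i * f i) \<le> c * \<nu> F f" using c by (intro mult_left_mono) auto
  moreover have "c * (\<Sum>i\<in>F. ?b i * f i) = (\<Sum>i\<in>F. \<bar>a i * f i\<bar>)"
    unfolding sum_distrib_left using c by (intro sum.cong) (auto simp: sgn_if abs_if)
  ultimately show ?thesis by simp
qed

end

text \<open>Common frame for \<open>c0_space\<close> and \<open>lp_space\<close>. By
  \<open>nu_le_N\<close> and \<open>N_le\<close>, \<open>N f\<close> is the supremum of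
  \<open>\<nu> F f\<close> over finite \<open>F \<subseteq> \<Gamma>\<close>. The tail condition in
  \<open>in_V_iff\<close> makes the finitely supported functions dense; for the maximum norm it
  singles out \<open>c_0\<close> among the bounded functions.\<close>

locale lq_dual_space = lq_dual_seminorms q \<nu>
  for q :: real and \<nu> :: "'i set \<Rightarrow> ('i \<Rightarrow> real) \<Rightarrow> real" +
  fixes \<Gamma> :: "'i set" and V :: "('i \<Rightarrow> real) set" and N :: "('i \<Rightarrow> real) \<Rightarrow> real"
  assumes uncountable_index: "uncountable \<Gamma>"
    and in_V_iff: "\<And>f. f \<in> V \<longleftrightarrow> (\<forall>i. i \<notin> \<Gamma> \<longrightarrow> f i = 0) \<and>
      (\<forall>\<epsilon>>0. \<exists>F. finite F \<and> F \<subseteq> \<Gamma> \<and> (\<forall>G. finite G \<and> G \<subseteq> \<Gamma> - F \<longrightarrow> \<nu> G f \<le> \<epsilon>))"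
    and nu_le_N: "\<And>f F. \<lbrakk>f \<in> V; finite F; F \<subseteq> \<Gamma>\<rbrakk> \<Longrightarrow> \<nu> F f \<le> N f"
    and N_le: "\<And>f c. \<lbrakk>f \<in> V; \<And>F. \<lbrakk>finite F; F \<subseteq> \<Gamma>\<rbrakk> \<Longrightarrow> \<nu> F f \<le> c\<rbrakk> \<Longrightarrow> N f \<le> c"
begin

section \<open>The space \<open>V\<close> is a nonseparable Banach space\<close>

lemma in_V_outside: "f \<in> V \<Longrightarrow> i \<notin> \<Gamma> \<Longrightarrow> f i = 0"
  by (simp add: in_V_iff)

lemma in_V_tail:
  assumes "f \<in> V" "\<epsilon> > 0"
  obtains F where "finite F" "F \<subseteq> \<Gamma>" "\<forall>G. finite G \<and> G \<subseteq> \<Gamma> - F \<longrightarrow> \<nu> G f \<le> \<epsilon>"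
  using assms unfolding in_V_iff by meson

lemma add_in_V:
  assumes "f \<in> V" "g \<in> V"
  shows "f + g \<in> V"
  unfolding in_V_iff
proof (intro conjI allI impI)
  fix \<epsilon> :: real assume "\<epsilon> > 0"
  then have e: "\<epsilon> / 2 > 0" by simp
  obtain F1 where F1: "finite F1" "F1 \<subseteq> \<Gamma>" "\<forall>G. finite G \<and> G \<subseteq> \<Gamma> - F1 \<longrightarrow> \<nu> G f \<le> \<epsilon> / 2"
    using in_V_tail[OF assms(1) e] .
  obtain F2 where F2: "finite F2" "F2 \<subseteq> \<Gamma>" "\<forall>G. finite G \<and> G \<subseteq> \<Gamma> - F2 \<longrightarrow> \<nu> G g \<le> \<epsilon> / 2"
    using in_V_tail[OF assms(2) e] .
  have "\<nu> G (f + g) \<le> \<epsilon>" if "finite G" "G \<subseteq> \<Gamma> - (F1 \<union> F2)" for G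
  proof -
    have "\<nu> G f \<le> \<epsilon> / 2" "\<nu> G g \<le> \<epsilon> / 2" using F1 F2 that by blast+
    then show ?thesis using nu_le_add[OF that(1), of "f + g" f g] by simp
  qed
  then show "\<exists>F. finite F \<and> F \<subseteq> \<Gamma> \<and> (\<forall>G. finite G \<and> G \<subseteq> \<Gamma> - F \<longrightarrow> \<nu> G (f + g) \<le> \<epsilon>)"
    using F1 F2 by (intro exI[of _ "F1 \<union> F2"]) auto
qed (use assms in \<open>simp add: in_V_outside\<close>)

lemma scaleR_in_V:
  assumes "f \<in> V"
  shows "c *\<^sub>R f \<in> V"
  unfolding in_V_iff
proof (intro conjI allI impI)
  fix \<epsilon> :: real assume "\<epsilon> > 0"
  \<comment> \<open>Adding 1 keeps the quotient meaningful when \<open>c = 0\<close>.\<close>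
  then have e: "\<epsilon> / (\<bar>c\<bar> + 1) > 0" by (simp add: add_nonneg_pos)
  obtain F where F: "finite F" "F \<subseteq> \<Gamma>" "\<forall>G. finite G \<and> G \<subseteq> \<Gamma> - F \<longrightarrow> \<nu> G f \<le> \<epsilon> / (\<bar>c\<bar> + 1)"
    using in_V_tail[OF assms e] .
  have "\<nu> G (c *\<^sub>R f) \<le> \<epsilon>" if "finite G" "G \<subseteq> \<Gamma> - F" for G
  proof -
    have "\<nu> G (c *\<^sub>R f) \<le> \<bar>c\<bar> * \<nu> G f" using that by (intro nu_scale_le) auto
    also have "\<dots> \<le> (\<bar>c\<bar> + 1) * (\<epsilon> / (\<bar>c\<bar> + 1))"
      using F(3) that nu_nonneg by (intro mult_mono) auto
    finally show ?thesis by simp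
  qed
  then show "\<exists>F. finite F \<and> F \<subseteq> \<Gamma> \<and> (\<forall>G. finite G \<and> G \<subseteq> \<Gamma> - F \<longrightarrow> \<nu> G (c *\<^sub>R f) \<le> \<epsilon>)"
    using F by (intro exI[of _ F]) auto
qed (use assms in \<open>simp add: in_V_outside\<close>)

lemma restrict0_in_V:
  assumes "finite F" "F \<subseteq> \<Gamma>"
  shows "restrict0 F f \<in> V"
  unfolding in_V_iff
proof (intro conjI allI impI)
  fix \<epsilon> :: real assume "\<epsilon> > 0"
  have "\<nu> G (restrict0 F f) \<le> \<epsilon>" if "finite G" "G \<subseteq> \<Gamma> - F" for G
  proof -
    have "\<nu> G (restrict0 F f) \<le> \<nu> {} (restrict0 F f)"
      using that by (intro nu_supported) (auto simp: restrict0_def)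
    then show ?thesis using \<open>\<epsilon> > 0\<close> by simp
  qed
  then show "\<exists>F'. finite F' \<and> F' \<subseteq> \<Gamma> \<and>
      (\<forall>G. finite G \<and> G \<subseteq> \<Gamma> - F' \<longrightarrow> \<nu> G (restrict0 F f) \<le> \<epsilon>)"
    using assms by (intro exI[of _ F]) auto
qed (use assms in \<open>auto simp: restrict0_def\<close>)

lemma N_restrict0_le:
  assumes "finite F" "F \<subseteq> \<Gamma>"
  shows "N (restrict0 F f) \<le> \<nu> F f"
proof (rule N_le[OF restrict0_in_V[OF assms]])
  fix G assume G: "finite G" "G \<subseteq> \<Gamma>"
  have "\<nu> G (restrict0 F f) \<le> \<nu> (G \<inter> F) (restrict0 F f)"
    using G by (intro nu_supported) (auto simp: restrict0_def)
  also have "\<dots> = \<nu> (G \<inter> F) f" using G by (intro nu_cong) (auto simp: restrict0_def)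
  also have "\<dots> \<le> \<nu> F f" using assms by (intro nu_mono) auto
  finally show "\<nu> G (restrict0 F f) \<le> \<nu> F f" .
qed

lemma subspace_V: "subspace V"
proof (rule subspaceI)
  have "restrict0 {} (\<lambda>_. 0) \<in> V" by (intro restrict0_in_V) auto
  moreover have "restrict0 {} (\<lambda>_. 0) = (0 :: 'i \<Rightarrow> real)" by (auto simp: restrict0_def)
  ultimately show "0 \<in> V" by simp
qed (auto intro: add_in_V scaleR_in_V)

lemma diff_in_V: "f \<in> V \<Longrightarrow> g \<in> V \<Longrightarrow> f - g \<in> V"
  using subspace_V by (rule subspace_diff)

lemma N_nonneg: "f \<in> V \<Longrightarrow> 0 \<le> N f"
  using nu_le_N[of f "{}"] by simp

lemma abs_le_N: "f \<in> V \<Longrightarrow> \<bar>f i\<bar> \<le> N f"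
proof (cases "i \<in> \<Gamma>")
  case True
  assume "f \<in> V"
  then show ?thesis using True abs_le_nu[of "{i}" i f] nu_le_N[of f "{i}"] by simp
next
  case False
  assume "f \<in> V"
  then show ?thesis using False by (simp add: in_V_outside N_nonneg)
qed

lemma N_triangle:
  assumes "f \<in> V" "g \<in> V"
  shows "N (f + g) \<le> N f + N g"
proof (rule N_le[OF add_in_V[OF assms]])
  fix F assume F: "finite F" "F \<subseteq> \<Gamma>"
  have "\<nu> F (f + g) \<le> \<nu> F f + \<nu> F g" using F by (intro nu_le_add) auto
  then show "\<nu> F (f + g) \<le> N f + N g"
    using nu_le_N[OF assms(1) F] nu_le_N[OF assms(2) F] by linarith
qed

lemma N_scaleR_le:
  assumes "f \<in> V"
  shows "N (c *\<^sub>R f) \<le> \<bar>c\<bar> * N f"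
proof (rule N_le[OF scaleR_in_V[OF assms]])
  fix F assume F: "finite F" "F \<subseteq> \<Gamma>"
  have "\<nu> F (c *\<^sub>R f) \<le> \<bar>c\<bar> * \<nu> F f" using F by (intro nu_scale_le) auto
  also have "\<dots> \<le> \<bar>c\<bar> * N f" using nu_le_N[OF assms F] by (intro mult_left_mono) auto
  finally show "\<nu> F (c *\<^sub>R f) \<le> \<bar>c\<bar> * N f" .
qed

lemma N_scaleR:
  assumes "f \<in> V"
  shows "N (c *\<^sub>R f) = \<bar>c\<bar> * N f"
proof (cases "c = 0")
  case True
  then show ?thesis
    using N_scaleR_le[OF assms, of c] N_nonneg[OF scaleR_in_V[OF assms], of c] by simp
next
  case False
  have "N f \<le> \<bar>1 / c\<bar> * N (c *\<^sub>R f)"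
    using N_scaleR_le[OF scaleR_in_V[OF assms], of "1 / c" c] False by simp
  then have "\<bar>c\<bar> * N f \<le> N (c *\<^sub>R f)" using False by (simp add: field_simps)
  then show ?thesis using N_scaleR_le[OF assms, of c] by simp
qed

lemma normed_space: "normed_space_on V N"
  unfolding normed_space_on_def
proof (intro conjI ballI allI)
  fix f assume f: "f \<in> V"
  show "0 \<le> N f" by (rule N_nonneg[OF f])
  show "N f = 0 \<longleftrightarrow> f = 0"
  proof
    assume "N f = 0"
    then show "f = 0" using abs_le_N[OF f] by (auto simp: fun_eq_iff)
  next
    assume "f = 0"
    then show "N f = 0" using N_scaleR[OF f, of 0] by simp
  qed
qed (auto simp: N_scaleR N_triangle subspace_V)

lemma N_minus_commute:
  assumes "f \<in> V" "g \<in> V"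
  shows "N (f - g) = N (g - f)"
  using N_scaleR[OF diff_in_V[OF assms], of "-1"] by simp

lemma metric_space: "Metric_space V (norm_dist V N)"
proof
  fix x y z :: "'i \<Rightarrow> real"
  show "0 \<le> norm_dist V N x y" by (simp add: norm_dist_def N_nonneg diff_in_V)
  show "norm_dist V N x y = norm_dist V N y x" by (simp add: norm_dist_def N_minus_commute)
  assume V: "x \<in> V" "y \<in> V"
  then show "norm_dist V N x y = 0 \<longleftrightarrow> x = y"
    using normed_space diff_in_V[OF V] by (simp add: norm_dist_def normed_space_on_def)
  assume "z \<in> V"
  then show "norm_dist V N x z \<le> norm_dist V N x y + norm_dist V N y z"
    using V N_triangle[of "x - y" "y - z"] by (simp add: norm_dist_def diff_in_V)
qed

text \<open>A Cauchy sequence converges in each coordinate. On finite sets the Cauchy bound survives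
  the passage to the limit \<open>f\<close>, uniformly in the finite set, which yields both
  \<open>f \<in> V\<close> and convergence in \<open>N\<close>.\<close>

lemma banach_space: "banach_space_on V N"
proof -
  interpret Metric_space V "norm_dist V N" by (rule metric_space)
  have "\<exists>x. limitin mtopology \<sigma> x sequentially" if C: "MCauchy \<sigma>" for \<sigma>
  proof -
    have sV: "\<sigma> n \<in> V" for n using C by (auto simp: MCauchy_def)
    have cau: "\<exists>k. \<forall>m\<ge>k. \<forall>n\<ge>k. N (\<sigma> m - \<sigma> n) < \<epsilon>" if "\<epsilon> > 0" for \<epsilon>
      using C that sV unfolding MCauchy_def norm_dist_def by simp
    have "Cauchy (\<lambda>n. \<sigma> n i)" for i
    proof (rule metric_CauchyI)
      fix \<epsilon> :: real assume "\<epsilon> > 0"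
      then obtain k where k: "\<forall>m\<ge>k. \<forall>n\<ge>k. N (\<sigma> m - \<sigma> n) < \<epsilon>" using cau by blast
      have "dist (\<sigma> m i) (\<sigma> n i) < \<epsilon>" if "m \<ge> k" "n \<ge> k" for m n
        using abs_le_N[OF diff_in_V[OF sV sV], of m n i] k[rule_format, OF that] by (simp add: dist_real_def)
      then show "\<exists>M. \<forall>m\<ge>M. \<forall>n\<ge>M. dist (\<sigma> m i) (\<sigma> n i) < \<epsilon>" by blast
    qed
    then have "convergent (\<lambda>n. \<sigma> n i)" for i by (rule Cauchy_convergent)
    then have "(\<lambda>n. \<sigma> n i) \<longlonglongrightarrow> lim (\<lambda>n. \<sigma> n i)" for i
      unfolding convergent_LIMSEQ_iff .
    then obtain f where f: "\<And>i. (\<lambda>n. \<sigma> n i) \<longlonglongrightarrow> f i" by (rule that)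
    have close: "\<exists>k. \<forall>n\<ge>k. \<forall>G. finite G \<and> G \<subseteq> \<Gamma> \<longrightarrow> \<nu> G (\<sigma> n - f) \<le> \<epsilon>" if e0: "\<epsilon> > 0" for \<epsilon>
    proof -
      obtain k where k: "\<forall>m\<ge>k. \<forall>n\<ge>k. N (\<sigma> m - \<sigma> n) < \<epsilon>" using cau[OF e0] by blast
      \<comment> \<open>Let \<open>m\<close> tend to infinity: the distance from
        \<open>\<sigma> n\<close> to \<open>f\<close> on \<open>G\<close> is at most the Cauchy
        bound plus the error of \<open>\<sigma> m\<close> on the finite set \<open>G\<close>, which
        vanishes in the limit.\<close>
      have "\<nu> G (\<sigma> n - f) \<le> \<epsilon>" if n: "n \<ge> k" and G: "finite G" "G \<subseteq> \<Gamma>" for n G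
      proof (rule tendsto_lowerbound)
        have "(\<lambda>m. \<epsilon> + (\<Sum>i\<in>G. \<bar>\<sigma> m i - f i\<bar>)) \<longlonglongrightarrow> \<epsilon> + (\<Sum>i\<in>G. \<bar>f i - f i\<bar>)"
          by (intro tendsto_intros f)
        then show "(\<lambda>m. \<epsilon> + (\<Sum>i\<in>G. \<bar>\<sigma> m i - f i\<bar>)) \<longlonglongrightarrow> \<epsilon>" by simp
        have "\<nu> G (\<sigma> n - f) \<le> \<epsilon> + (\<Sum>i\<in>G. \<bar>\<sigma> m i - f i\<bar>)" if "m \<ge> k" for m
        proof -
          have "\<nu> G (\<sigma> n - f) \<le> \<nu> G (\<sigma> n - \<sigma> m) + \<nu> G (\<sigma> m - f)"
            using G by (intro nu_le_add) auto
          moreover have "\<nu> G (\<sigma> n - \<sigma> m) \<le> N (\<sigma> n - \<sigma> m)" using sV G by (intro nu_le_N diff_in_V)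
          moreover have "N (\<sigma> n - \<sigma> m) < \<epsilon>" using k n that by blast
          moreover have "\<nu> G (\<sigma> m - f) \<le> (\<Sum>i\<in>G. \<bar>\<sigma> m i - f i\<bar>)"
            using nu_le_sum[OF G(1), of "\<sigma> m - f"] by simp
          ultimately show ?thesis by linarith
        qed
        then show "\<forall>\<^sub>F m in sequentially. \<nu> G (\<sigma> n - f) \<le> \<epsilon> + (\<Sum>i\<in>G. \<bar>\<sigma> m i - f i\<bar>)"
          unfolding eventually_sequentially by blast
      qed simp
      then show ?thesis by blast
    qed
    have "f \<in> V"
      unfolding in_V_iff
    proof (intro conjI allI impI)
      fix i assume "i \<notin> \<Gamma>"
      then have "(\<lambda>n. \<sigma> n i) \<longlonglongrightarrow> 0" using in_V_outside[OF sV] by simp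
      then show "f i = 0" using f LIMSEQ_unique by blast
    next
      fix \<epsilon> :: real assume "\<epsilon> > 0"
      then have e: "\<epsilon> / 2 > 0" by simp
      obtain n where n: "\<forall>G. finite G \<and> G \<subseteq> \<Gamma> \<longrightarrow> \<nu> G (\<sigma> n - f) \<le> \<epsilon> / 2"
        using close[OF e] by blast
      obtain F where F: "finite F" "F \<subseteq> \<Gamma>" "\<forall>G. finite G \<and> G \<subseteq> \<Gamma> - F \<longrightarrow> \<nu> G (\<sigma> n) \<le> \<epsilon> / 2"
        using in_V_tail[OF sV e] .
      have "\<nu> G f \<le> \<epsilon>" if G: "finite G" "G \<subseteq> \<Gamma> - F" for G
      proof -
        have "\<nu> G f \<le> \<nu> G (\<sigma> n) + \<nu> G (f - \<sigma> n)" using G by (intro nu_le_add) auto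
        moreover have "\<nu> G (f - \<sigma> n) \<le> \<bar>-1\<bar> * \<nu> G (\<sigma> n - f)"
          using G(1) by (intro nu_scale_le) auto
        moreover have "\<nu> G (\<sigma> n - f) \<le> \<epsilon> / 2" using n G by blast
        moreover have "\<nu> G (\<sigma> n) \<le> \<epsilon> / 2" using F G by blast
        ultimately show ?thesis by simp
      qed
      then show "\<exists>F. finite F \<and> F \<subseteq> \<Gamma> \<and> (\<forall>G. finite G \<and> G \<subseteq> \<Gamma> - F \<longrightarrow> \<nu> G f \<le> \<epsilon>)"
        using F by (intro exI[of _ F]) auto
    qed
    moreover have "\<exists>k. \<forall>n\<ge>k. norm_dist V N (\<sigma> n) f < \<epsilon>" if "\<epsilon> > 0" for \<epsilon>
    proof -
      have e: "\<epsilon> / 2 > 0" using that by simp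
      obtain k where k: "\<forall>n\<ge>k. \<forall>G. finite G \<and> G \<subseteq> \<Gamma> \<longrightarrow> \<nu> G (\<sigma> n - f) \<le> \<epsilon> / 2"
        using close[OF e] by blast
      have "N (\<sigma> n - f) \<le> \<epsilon> / 2" if "n \<ge> k" for n
        using k that by (intro N_le diff_in_V sV \<open>f \<in> V\<close>) blast
      then have "norm_dist V N (\<sigma> n) f < \<epsilon>" if "n \<ge> k" for n
        using that e sV \<open>f \<in> V\<close> unfolding norm_dist_def by fastforce
      then show ?thesis by blast
    qed
    ultimately have "limitin mtopology \<sigma> f sequentially"
      using sV unfolding limitin_metric eventually_sequentially by (simp add: sV)
    then show ?thesis by blast
  qed
  then have "mcomplete" unfolding mcomplete_def by blast
  then show ?thesis by (simp add: banach_space_on_def normed_space)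
qed

lemma unit_vec_in_V:
  assumes "i \<in> \<Gamma>"
  shows "unit_vec i \<in> V"
proof -
  have "restrict0 {i} (\<lambda>_. 1) \<in> V" using assms by (intro restrict0_in_V) auto
  moreover have "restrict0 {i} (\<lambda>_. 1) = unit_vec i" by (auto simp: restrict0_def unit_vec_def)
  ultimately show ?thesis by simp
qed

text \<open>A point closer than 1/2 to \<open>unit_vec i\<close> has entry above 1/2 at
  \<open>i\<close>, while a point closer than 1/2 to another unit vector has entry below 1/2 there.
  Hence a dense set would contain a copy of \<Gamma>.\<close>

lemma not_separable: "\<not> separable_on V N"
proof
  interpret Metric_space V "norm_dist V N" by (rule metric_space)
  assume "separable_on V N"
  then obtain C where C: "C \<subseteq> V" "countable C" "mtopology closure_of C = V"
    unfolding separable_on_def by blast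
  have "\<exists>c. c \<in> C \<and> N (unit_vec i - c) < 1 / 2" if "i \<in> \<Gamma>" for i
  proof -
    have "unit_vec i \<in> mtopology closure_of C" using C(3) unit_vec_in_V[OF that] by simp
    moreover have "(1 / 2 :: real) > 0" by simp
    ultimately have "\<exists>y\<in>C. y \<in> mball (unit_vec i) (1 / 2)" unfolding metric_closure_of by blast
    then show ?thesis using unit_vec_in_V[OF that] by (auto simp: in_mball norm_dist_def)
  qed
  then obtain c where c: "\<And>i. i \<in> \<Gamma> \<Longrightarrow> c i \<in> C" "\<And>i. i \<in> \<Gamma> \<Longrightarrow> N (unit_vec i - c i) < 1 / 2"
    by metis
  have near: "\<bar>unit_vec i j - c i j\<bar> < 1 / 2" if "i \<in> \<Gamma>" for i j
  proof -
    have "unit_vec i - c i \<in> V" using that c C by (intro diff_in_V unit_vec_in_V) auto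
    from abs_le_N[OF this, of j] show ?thesis using c(2)[OF that] by simp
  qed
  have "inj_on c \<Gamma>"
  proof (rule inj_onI, rule ccontr)
    fix i j assume ij: "i \<in> \<Gamma>" "j \<in> \<Gamma>" "c i = c j" "i \<noteq> j"
    show False using near[OF ij(1), of i] near[OF ij(2), of i] ij(3,4) by (simp add: unit_vec_def)
  qed
  moreover have "countable (c ` \<Gamma>)" using C(2) c(1) by (auto intro: countable_subset)
  ultimately show False using uncountable_index countable_image_inj_on by blast
qed

lemma restrict0_dense:
  assumes f: "f \<in> V" and "\<epsilon> > 0"
  obtains F where "finite F" "F \<subseteq> \<Gamma>" "N (f - restrict0 F f) \<le> \<epsilon>"
proof -
  obtain F where F: "finite F" "F \<subseteq> \<Gamma>" "\<forall>G. finite G \<and> G \<subseteq> \<Gamma> - F \<longrightarrow> \<nu> G f \<le> \<epsilon>"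
    using in_V_tail[OF assms] .
  have "N (f - restrict0 F f) \<le> \<epsilon>"
  proof (rule N_le[OF diff_in_V[OF f restrict0_in_V[OF F(1,2)]]])
    fix G assume G: "finite G" "G \<subseteq> \<Gamma>"
    have "\<nu> G (f - restrict0 F f) \<le> \<nu> (G - F) (f - restrict0 F f)"
      using G by (intro nu_supported) (auto simp: restrict0_def)
    also have "\<dots> = \<nu> (G - F) f" using G by (intro nu_cong) (auto simp: restrict0_def)
    also have "\<dots> \<le> \<epsilon>" using F(3) G by blast
    finally show "\<nu> G (f - restrict0 F f) \<le> \<epsilon>" .
  qed
  with F show ?thesis by (intro that)
qed

end

section \<open>The dual ball\<close>

lemma closedin_Collect_ball:
  assumes "\<And>z. z \<in> Z \<Longrightarrow> closedin X {x \<in> topspace X. P z x}"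
  shows "closedin X {x \<in> topspace X. \<forall>z\<in>Z. P z x}"
proof -
  have "closedin X (\<Inter>(insert (topspace X) ((\<lambda>z. {x \<in> topspace X. P z x}) ` Z)))"
    using assms by (intro closedin_Inter) auto
  moreover have "\<Inter>(insert (topspace X) ((\<lambda>z. {x \<in> topspace X. P z x}) ` Z)) =
      {x \<in> topspace X. \<forall>z\<in>Z. P z x}" by auto
  ultimately show ?thesis by simp
qed

context lq_dual_space
begin

text \<open>The conditions of \<open>dual_space\<close> apart from extensionality, so that they also
  apply to a pointwise difference of functionals, whose value off \<open>V\<close> need not be
  \<open>undefined\<close>.\<close>

definition bounded_functional :: "(('i \<Rightarrow> real) \<Rightarrow> real) \<Rightarrow> bool" where
  "bounded_functional \<phi> \<longleftrightarrow>
     (\<forall>x\<in>V. \<forall>y\<in>V. \<phi> (x + y) = \<phi> x + \<phi> y) \<and> (\<forall>c. \<forall>x\<in>V. \<phi> (c *\<^sub>R x) = c * \<phi> x) \<and>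
     (\<exists>C. \<forall>x\<in>V. \<bar>\<phi> x\<bar> \<le> C * N x)"

lemma dual_space_iff: "\<phi> \<in> dual_space V N \<longleftrightarrow> \<phi> \<in> extensional V \<and> bounded_functional \<phi>"
  by (simp add: dual_space_def bounded_functional_def)

section \<open>Bounded functionals, their dual norm and their coordinates\<close>

lemma functional_add: "\<lbrakk>bounded_functional \<phi>; x \<in> V; y \<in> V\<rbrakk> \<Longrightarrow> \<phi> (x + y) = \<phi> x + \<phi> y"
  by (simp add: bounded_functional_def)

lemma functional_scale: "\<lbrakk>bounded_functional \<phi>; x \<in> V\<rbrakk> \<Longrightarrow> \<phi> (c *\<^sub>R x) = c * \<phi> x"
  by (simp add: bounded_functional_def)

lemma functional_zero: "bounded_functional \<phi> \<Longrightarrow> \<phi> 0 = 0"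
  using functional_scale[of \<phi> 0 0] subspace_0[OF subspace_V] by simp

lemma functional_diff:
  assumes "bounded_functional \<phi>" "x \<in> V" "y \<in> V"
  shows "\<phi> (x - y) = \<phi> x - \<phi> y"
  using functional_add[OF assms(1) diff_in_V[OF assms(2,3)] assms(3)] by simp

lemma bounded_functional_minus:
  assumes "bounded_functional \<phi>" "bounded_functional \<psi>"
  shows "bounded_functional (\<lambda>v. \<phi> v - \<psi> v)"
proof -
  obtain C D where C: "\<forall>x\<in>V. \<bar>\<phi> x\<bar> \<le> C * N x" and D: "\<forall>x\<in>V. \<bar>\<psi> x\<bar> \<le> D * N x"
    using assms unfolding bounded_functional_def by meson
  have "\<bar>\<phi> x - \<psi> x\<bar> \<le> (C + D) * N x" if "x \<in> V" for x
  proof -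
    have "\<bar>\<phi> x - \<psi> x\<bar> \<le> C * N x + D * N x" using C D that by (smt (verit))
    then show ?thesis by (simp add: algebra_simps)
  qed
  then have "\<exists>C. \<forall>x\<in>V. \<bar>\<phi> x - \<psi> x\<bar> \<le> C * N x" by blast
  then show ?thesis
    using assms by (simp add: bounded_functional_def algebra_simps)
qed

lemma abs_le_dual_norm_unit:
  assumes \<phi>: "bounded_functional \<phi>" and f: "f \<in> V" "N f \<le> 1"
  shows "\<bar>\<phi> f\<bar> \<le> dual_norm V N \<phi>"
  unfolding dual_norm_def
proof (rule cSUP_upper)
  obtain C where C: "\<forall>x\<in>V. \<bar>\<phi> x\<bar> \<le> C * N x" using \<phi> unfolding bounded_functional_def by meson
  have "\<bar>\<phi> x\<bar> \<le> \<bar>C\<bar>" if "x \<in> V" "N x \<le> 1" for x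
  proof -
    have "\<bar>\<phi> x\<bar> \<le> C * N x" using C that by blast
    also have "\<dots> \<le> \<bar>C\<bar> * 1" using that N_nonneg by (intro mult_mono) auto
    finally show ?thesis by simp
  qed
  then show "bdd_above ((\<lambda>x. \<bar>\<phi> x\<bar>) ` {x \<in> V. N x \<le> 1})" by (intro bdd_aboveI2) auto
qed (use f in simp)

lemma N_zero: "N 0 = 0"
  using N_scaleR[OF subspace_0[OF subspace_V], of 0] by simp

lemma dual_norm_le:
  assumes "\<And>f. \<lbrakk>f \<in> V; N f \<le> 1\<rbrakk> \<Longrightarrow> \<bar>\<phi> f\<bar> \<le> c"
  shows "dual_norm V N \<phi> \<le> c"
  unfolding dual_norm_def
  using assms subspace_0[OF subspace_V] N_zero by (intro cSUP_least) auto

lemma dual_norm_nonneg: "bounded_functional \<phi> \<Longrightarrow> 0 \<le> dual_norm V N \<phi>"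
  using abs_le_dual_norm_unit[of \<phi> 0] subspace_0[OF subspace_V] N_zero by auto

lemma abs_le_dual_norm:
  assumes \<phi>: "bounded_functional \<phi>" and f: "f \<in> V"
  shows "\<bar>\<phi> f\<bar> \<le> dual_norm V N \<phi> * N f"
proof (cases "N f = 0")
  case True
  then have "f = 0" using f normed_space by (simp add: normed_space_on_def)
  then show ?thesis using functional_zero[OF \<phi>] True by simp
next
  case False
  then have pos: "N f > 0" using N_nonneg[OF f] by simp
  have "N ((1 / N f) *\<^sub>R f) = 1" unfolding N_scaleR[OF f] using pos by simp
  then have "\<bar>\<phi> ((1 / N f) *\<^sub>R f)\<bar> \<le> dual_norm V N \<phi>"
    by (intro abs_le_dual_norm_unit \<phi> scaleR_in_V f) linarith
  then show ?thesis unfolding functional_scale[OF \<phi> f] using pos by (simp add: abs_mult field_simps)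
qed

lemma functional_restrict0:
  assumes \<phi>: "bounded_functional \<phi>" and "finite F" "F \<subseteq> \<Gamma>"
  shows "\<phi> (restrict0 F f) = (\<Sum>i\<in>F. \<phi> (unit_vec i) * f i)"
  using assms(2,3)
proof (induction F)
  case empty
  have "restrict0 {} f = 0" by (auto simp: restrict0_def)
  then show ?case unfolding sum.empty by (simp only: functional_zero[OF \<phi>])
next
  case (insert j F)
  have "restrict0 (insert j F) f = restrict0 F f + f j *\<^sub>R unit_vec j"
    using insert.hyps by (auto simp: restrict0_def unit_vec_def fun_eq_iff)
  moreover have "restrict0 F f \<in> V" "unit_vec j \<in> V"
    using insert by (auto intro: restrict0_in_V unit_vec_in_V)
  ultimately have "\<phi> (restrict0 (insert j F) f) = \<phi> (restrict0 F f) + f j * \<phi> (unit_vec j)"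
    by (simp only: functional_add[OF \<phi>] functional_scale[OF \<phi>] scaleR_in_V)
  then show ?case using insert by simp
qed

text \<open>A vector \<open>f\<close> that norms the coordinates on \<open>F\<close>, extended by
  zero, lies in the unit ball of \<open>V\<close>; evaluating \<phi> at it gives the
  \<open>q\<close>-norm of these coordinates.\<close>

lemma sum_powr_le_dual_norm:
  assumes \<phi>: "bounded_functional \<phi>" and F: "finite F" "F \<subseteq> \<Gamma>"
  shows "(\<Sum>i\<in>F. \<bar>\<phi> (unit_vec i)\<bar> powr q) \<le> dual_norm V N \<phi> powr q"
proof -
  let ?S = "\<Sum>i\<in>F. \<bar>\<phi> (unit_vec i)\<bar> powr q"
  obtain f where f: "\<nu> F f \<le> 1" "(\<Sum>i\<in>F. \<phi> (unit_vec i) * f i) = ?S powr (1 / q)"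
    using dual_norming[OF F(1), of "\<lambda>i. \<phi> (unit_vec i)"] by auto
  have "\<bar>\<phi> (restrict0 F f)\<bar> \<le> dual_norm V N \<phi>"
    using N_restrict0_le[OF F, of f] f(1) by (intro abs_le_dual_norm_unit \<phi> restrict0_in_V F) auto
  then have "?S powr (1 / q) \<le> dual_norm V N \<phi>"
    using functional_restrict0[OF \<phi> F, of f] f(2) by simp
  then have "(?S powr (1 / q)) powr q \<le> dual_norm V N \<phi> powr q"
    using q_ge_1 by (intro powr_mono2) auto
  moreover have "(?S powr (1 / q)) powr q = ?S"
    using q_ge_1 by (simp add: powr_powr sum_nonneg)
  ultimately show ?thesis by simp
qed

text \<open>Converse to \<open>sum_powr_le_dual_norm\<close>: Hoelder's inequality bounds \<phi> on
  a finitely supported approximation of \<open>f\<close>, and the boundedness of \<phi> makes the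
  remainder negligible. Together the two bounds say that the dual norm is the \<open>q\<close>-norm
  of the coordinates.\<close>

lemma dual_norm_le_of_sums:
  assumes \<phi>: "bounded_functional \<phi>" and c: "0 \<le> c"
    and sums: "\<And>F. \<lbrakk>finite F; F \<subseteq> \<Gamma>\<rbrakk> \<Longrightarrow> (\<Sum>i\<in>F. \<bar>\<phi> (unit_vec i)\<bar> powr q) \<le> c powr q"
  shows "dual_norm V N \<phi> \<le> c"
proof (rule dual_norm_le)
  fix f assume f: "f \<in> V" "N f \<le> 1"
  let ?D = "dual_norm V N \<phi>"
  have D: "0 \<le> ?D" by (rule dual_norm_nonneg[OF \<phi>])
  show "\<bar>\<phi> f\<bar> \<le> c"
  proof (rule field_le_epsilon)
    fix \<epsilon> :: real assume "\<epsilon> > 0"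
    \<comment> \<open>The remainder is multiplied by \<open>?D\<close>, which may be 0; hence the
      denominator \<open>?D + 1\<close>.\<close>
    then have e: "\<epsilon> / (?D + 1) > 0" using D by simp
    obtain F where F: "finite F" "F \<subseteq> \<Gamma>" and NF: "N (f - restrict0 F f) \<le> \<epsilon> / (?D + 1)"
      using restrict0_dense[OF f(1) e] .
    have r: "restrict0 F f \<in> V" using F by (rule restrict0_in_V)
    have "\<bar>\<phi> (restrict0 F f)\<bar> \<le> (\<Sum>i\<in>F. \<bar>\<phi> (unit_vec i) * f i\<bar>)"
      unfolding functional_restrict0[OF \<phi> F] by (rule sum_abs)
    also have "\<dots> \<le> c * \<nu> F f" using F c sums by (intro hoelder_general)
    also have "\<dots> \<le> c * 1" using nu_le_N[OF f(1) F] f(2) c by (intro mult_left_mono) auto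
    finally have 1: "\<bar>\<phi> (restrict0 F f)\<bar> \<le> c" by simp
    have "\<bar>\<phi> (f - restrict0 F f)\<bar> \<le> ?D * N (f - restrict0 F f)"
      by (intro abs_le_dual_norm \<phi> diff_in_V f r)
    also have "\<dots> \<le> (?D + 1) * (\<epsilon> / (?D + 1))"
      using NF D N_nonneg[OF diff_in_V[OF f(1) r]] by (intro mult_mono) auto
    also have "\<dots> = \<epsilon>" using D by simp
    finally have 2: "\<bar>\<phi> (f - restrict0 F f)\<bar> \<le> \<epsilon>" .
    show "\<bar>\<phi> f\<bar> \<le> c + \<epsilon>" using 1 2 functional_diff[OF \<phi> f(1) r] by linarith
  qed
qed

text \<open>The difference has zero coordinates, hence dual norm 0 by
  \<open>dual_norm_le_of_sums\<close> with \<open>c = 0\<close>.\<close>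

lemma dual_space_eqI:
  assumes \<phi>: "\<phi> \<in> dual_space V N" and \<psi>: "\<psi> \<in> dual_space V N"
    and eq: "\<And>i. i \<in> \<Gamma> \<Longrightarrow> \<phi> (unit_vec i) = \<psi> (unit_vec i)"
  shows "\<phi> = \<psi>"
proof (rule extensionalityI)
  show "\<phi> \<in> extensional V" "\<psi> \<in> extensional V" using \<phi> \<psi> by (auto simp: dual_space_iff)
  let ?d = "\<lambda>v. \<phi> v - \<psi> v"
  have d: "bounded_functional ?d" using \<phi> \<psi> by (intro bounded_functional_minus) (auto simp: dual_space_iff)
  have "dual_norm V N ?d \<le> 0"
  proof (rule dual_norm_le_of_sums[OF d])
    fix F assume F: "F \<subseteq> \<Gamma>"
    have "(\<Sum>i\<in>F. \<bar>\<phi> (unit_vec i) - \<psi> (unit_vec i)\<bar> powr q) = (\<Sum>i\<in>F. 0)"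
      using F eq by (intro sum.cong) auto
    then show "(\<Sum>i\<in>F. \<bar>\<phi> (unit_vec i) - \<psi> (unit_vec i)\<bar> powr q) \<le> 0 powr q" by simp
  qed simp
  fix f assume f: "f \<in> V"
  have "\<bar>?d f\<bar> \<le> dual_norm V N ?d * N f" by (rule abs_le_dual_norm[OF d f])
  also have "\<dots> \<le> 0"
    using \<open>dual_norm V N ?d \<le> 0\<close> N_nonneg[OF f] by (simp add: mult_nonpos_nonneg)
  finally show "\<phi> f = \<psi> f" by simp
qed

lemma dual_ball_iff:
  "\<phi> \<in> dual_ball V N \<longleftrightarrow> \<phi> \<in> extensional V \<and> bounded_functional \<phi> \<and> dual_norm V N \<phi> \<le> 1"
  by (auto simp: dual_ball_def dual_space_iff)

lemma dual_ball_sum_le_1: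
  assumes "\<phi> \<in> dual_ball V N" "finite F" "F \<subseteq> \<Gamma>"
  shows "(\<Sum>i\<in>F. \<bar>\<phi> (unit_vec i)\<bar> powr q) \<le> 1"
proof -
  have \<phi>: "bounded_functional \<phi>" "dual_norm V N \<phi> \<le> 1" using assms(1) by (auto simp: dual_ball_iff)
  have "(\<Sum>i\<in>F. \<bar>\<phi> (unit_vec i)\<bar> powr q) \<le> dual_norm V N \<phi> powr q"
    by (rule sum_powr_le_dual_norm[OF \<phi>(1) assms(2,3)])
  also have "\<dots> \<le> 1 powr q" using \<phi> dual_norm_nonneg q_ge_1 by (intro powr_mono2) auto
  finally show ?thesis by simp
qed

text \<open>The functional is \<open>\<Sum>a i * f i\<close>, absolutely convergent by the Hoelder
  bound on finite sets. With \<open>dual_ball_sum_le_1\<close> and \<open>dual_space_eqI\<close>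
  this makes the coordinate map a bijection from the dual ball onto the
  \<open>q\<close>-ball.\<close>

lemma dual_ball_with_coordinates:
  assumes sums: "\<And>F. \<lbrakk>finite F; F \<subseteq> \<Gamma>\<rbrakk> \<Longrightarrow> (\<Sum>i\<in>F. \<bar>a i\<bar> powr q) \<le> 1"
  obtains \<phi> where "\<phi> \<in> dual_ball V N" "\<And>i. i \<in> \<Gamma> \<Longrightarrow> \<phi> (unit_vec i) = a i"
proof -
  have bound: "(\<Sum>i\<in>F. \<bar>a i * f i\<bar>) \<le> N f" if "f \<in> V" "finite F" "F \<subseteq> \<Gamma>" for f F
  proof -
    have "(\<Sum>i\<in>F. \<bar>a i * f i\<bar>) \<le> 1 * \<nu> F f" using that sums by (intro hoelder_general) auto
    then show ?thesis using nu_le_N[OF that] by linarith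
  qed
  have abs_summable: "(\<lambda>i. norm (a i * f i)) summable_on \<Gamma>" if "f \<in> V" for f
    unfolding real_norm_def using bound[OF that]
    by (intro nonneg_bdd_above_summable_on bdd_aboveI2[of _ _ "N f"]) auto
  have summable: "(\<lambda>i. a i * f i) summable_on \<Gamma>" if "f \<in> V" for f
    using abs_summable[OF that] by (rule abs_summable_summable)
  define \<phi> where "\<phi> = restrict (\<lambda>f. \<Sum>\<^sub>\<infinity>i\<in>\<Gamma>. a i * f i) V"
  have le: "\<bar>\<phi> f\<bar> \<le> N f" if "f \<in> V" for f
  proof -
    have "\<bar>\<phi> f\<bar> \<le> (\<Sum>\<^sub>\<infinity>i\<in>\<Gamma>. \<bar>a i * f i\<bar>)"
      using norm_infsum_bound[OF abs_summable[OF that]] that by (simp add: \<phi>_def)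
    also have "\<dots> \<le> N f"
      using abs_summable[OF that] bound[OF that] by (intro infsum_le_finite_sums) auto
    finally show ?thesis .
  qed
  have "bounded_functional \<phi>"
    unfolding bounded_functional_def
  proof (intro conjI ballI allI exI[of _ 1])
    fix f g assume "f \<in> V" "g \<in> V"
    then show "\<phi> (f + g) = \<phi> f + \<phi> g"
      using infsum_add[OF summable summable, of f g] add_in_V[of f g]
      by (simp add: \<phi>_def algebra_simps)
  next
    fix c f assume f: "f \<in> V"
    have "(\<Sum>\<^sub>\<infinity>i\<in>\<Gamma>. a i * (c * f i)) = c * (\<Sum>\<^sub>\<infinity>i\<in>\<Gamma>. a i * f i)"
      unfolding infsum_cmult_right'[symmetric] by (simp add: mult.left_commute)
    then show "\<phi> (c *\<^sub>R f) = c * \<phi> f" using f scaleR_in_V[OF f, of c] by (simp add: \<phi>_def)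
  qed (use le in simp)
  moreover have "dual_norm V N \<phi> \<le> 1"
  proof (rule dual_norm_le)
    fix f assume "f \<in> V" "N f \<le> 1"
    then show "\<bar>\<phi> f\<bar> \<le> 1" using le[of f] by linarith
  qed
  moreover have "\<phi> \<in> extensional V" by (simp add: \<phi>_def)
  ultimately have "\<phi> \<in> dual_ball V N" by (simp add: dual_ball_iff)
  moreover have "\<phi> (unit_vec i) = a i" if i: "i \<in> \<Gamma>" for i
  proof -
    have "((\<lambda>j. a j * unit_vec i j) has_sum a i) \<Gamma>"
      using i by (intro has_sum_finite_neutralI[of "{i}"]) (auto simp: unit_vec_def)
    then show ?thesis using unit_vec_in_V[OF i] by (simp add: \<phi>_def infsumI)
  qed
  ultimately show ?thesis by (rule that)
qed

section \<open>The weak-star topology of the ball\<close>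

lemma topspace_weak_star_ball: "topspace (weak_star_ball V N) = dual_ball V N"
  by (auto simp: weak_star_ball_def dual_ball_iff PiE_def)

lemma continuous_map_evaluation:
  assumes "v \<in> V"
  shows "continuous_map (weak_star_ball V N) euclideanreal (\<lambda>\<phi>. \<phi> v)"
  unfolding weak_star_ball_def
  using assms by (intro continuous_map_from_subtopology continuous_map_product_projection)

text \<open>Replaces the dual norm by pointwise conditions, each of which is closed for the product
  topology.\<close>

lemma dual_ball_alt:
  "\<phi> \<in> dual_ball V N \<longleftrightarrow> \<phi> \<in> extensional V \<and> (\<forall>x\<in>V. \<forall>y\<in>V. \<phi> (x + y) = \<phi> x + \<phi> y) \<and>
     (\<forall>c. \<forall>x\<in>V. \<phi> (c *\<^sub>R x) = c * \<phi> x) \<and> (\<forall>x\<in>V. \<bar>\<phi> x\<bar> \<le> N x)"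
    (is "?L \<longleftrightarrow> ?R")
proof
  assume L: ?L
  have "\<bar>\<phi> x\<bar> \<le> N x" if x: "x \<in> V" for x
  proof -
    have "\<bar>\<phi> x\<bar> \<le> dual_norm V N \<phi> * N x" using L x by (intro abs_le_dual_norm) (auto simp: dual_ball_iff)
    also have "\<dots> \<le> 1 * N x" using L N_nonneg[OF x] by (intro mult_right_mono) (auto simp: dual_ball_iff)
    finally show ?thesis by simp
  qed
  then show ?R using L by (simp add: dual_ball_iff bounded_functional_def)
next
  assume R: ?R
  then have "\<forall>x\<in>V. \<bar>\<phi> x\<bar> \<le> 1 * N x" by simp
  then have "bounded_functional \<phi>" unfolding bounded_functional_def using R by blast
  moreover have "dual_norm V N \<phi> \<le> 1"
    using R by (intro dual_norm_le) force
  ultimately show ?L using R by (simp add: dual_ball_iff)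
qed

text \<open>Banach-Alaoglu: the ball is a closed subset of a compact box of intervals.\<close>

lemma compact_space_weak_star_ball: "compact_space (weak_star_ball V N)"
proof -
  let ?P = "product_topology (\<lambda>_. euclideanreal) V"
  have T: "topspace ?P = extensional V" by (simp add: PiE_def)
  have ev: "continuous_map ?P euclideanreal (\<lambda>\<phi>. \<phi> v)" if "v \<in> V" for v
    using that by (rule continuous_map_product_projection)
  let ?box = "PiE V (\<lambda>v. {- N v..N v})"
  \<comment> \<open>Linearity is written as differences lying in \<open>{0}\<close>, so that the
    conditions become preimages of a closed set under continuous maps.\<close>
  let ?add = "{\<phi> \<in> topspace ?P. \<forall>x\<in>V. \<forall>y\<in>V. \<phi> (x + y) - \<phi> x - \<phi> y \<in> {0}}"
  let ?scale = "{\<phi> \<in> topspace ?P. \<forall>c\<in>UNIV. \<forall>x\<in>V. \<phi> (c *\<^sub>R x) - c * \<phi> x \<in> {0}}"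
  have add: "closedin ?P ?add"
    by (intro closedin_Collect_ball closedin_continuous_map_preimage[of _ euclideanreal]
        continuous_map_diff ev add_in_V) auto
  have scale: "closedin ?P ?scale"
    by (intro closedin_Collect_ball closedin_continuous_map_preimage[of _ euclideanreal]
        continuous_map_diff continuous_map_real_mult_left ev scaleR_in_V) auto
  have "compactin ?P ?box" by (simp add: compactin_PiE)
  then have "compactin ?P (?box \<inter> (?add \<inter> ?scale))"
    using closedin_Int[OF add scale] by (rule compact_Int_closedin)
  moreover have "?box \<inter> (?add \<inter> ?scale) = dual_ball V N"
  proof (intro set_eqI)
    fix \<phi>
    have "\<phi> \<in> ?box \<longleftrightarrow> \<phi> \<in> extensional V \<and> (\<forall>x\<in>V. \<bar>\<phi> x\<bar> \<le> N x)"
      unfolding PiE_iff abs_le_iff by fastforce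
    then show "\<phi> \<in> ?box \<inter> (?add \<inter> ?scale) \<longleftrightarrow> \<phi> \<in> dual_ball V N"
      unfolding dual_ball_alt T by (simp add: algebra_simps) meson
  qed
  ultimately show ?thesis
    unfolding weak_star_ball_def by (simp add: compact_space_subtopology)
qed

text \<open>Convergence at unit vectors extends to finitely supported functions by linearity and to
  all of \<open>V\<close> by density, since every functional in the ball satisfies
  \<open>\<bar>\<phi> v\<bar> \<le> N v\<close>.\<close>

lemma limitin_weak_star_ball_iff:
  assumes xs: "\<And>n. xs n \<in> dual_ball V N" and x: "x \<in> dual_ball V N"
  shows "limitin (weak_star_ball V N) xs x sequentially \<longleftrightarrow>
    (\<forall>i\<in>\<Gamma>. (\<lambda>n. xs n (unit_vec i)) \<longlonglongrightarrow> x (unit_vec i))"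
proof
  assume L: "limitin (weak_star_ball V N) xs x sequentially"
  show "\<forall>i\<in>\<Gamma>. (\<lambda>n. xs n (unit_vec i)) \<longlonglongrightarrow> x (unit_vec i)"
    using continuous_map_limit[OF continuous_map_evaluation[OF unit_vec_in_V] L] by (simp add: o_def)
next
  assume R: "\<forall>i\<in>\<Gamma>. (\<lambda>n. xs n (unit_vec i)) \<longlonglongrightarrow> x (unit_vec i)"
  have bf: "bounded_functional (xs n)" "bounded_functional x" for n
    using xs x by (auto simp: dual_ball_iff)
  have le: "\<bar>xs n v\<bar> \<le> N v" "\<bar>x v\<bar> \<le> N v" if "v \<in> V" for n v
    using xs x that by (auto simp: dual_ball_alt)
  have "(\<lambda>n. xs n v) \<longlonglongrightarrow> x v" if v: "v \<in> V" for v
  proof (rule LIMSEQ_I)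
    fix \<epsilon> :: real assume "\<epsilon> > 0"
    then have e: "\<epsilon> / 4 > 0" by simp
    obtain F where F: "finite F" "F \<subseteq> \<Gamma>" and NF: "N (v - restrict0 F v) \<le> \<epsilon> / 4"
      using restrict0_dense[OF v e] .
    have r: "restrict0 F v \<in> V" using F by (rule restrict0_in_V)
    have "(\<lambda>n. xs n (restrict0 F v)) \<longlonglongrightarrow> x (restrict0 F v)"
      unfolding functional_restrict0[OF bf(1) F] functional_restrict0[OF bf(2) F]
      using R F by (intro tendsto_intros) auto
    then obtain k where k: "\<forall>n\<ge>k. norm (xs n (restrict0 F v) - x (restrict0 F v)) < \<epsilon> / 4"
      using LIMSEQ_D[OF _ e] by blast
    have "norm (xs n v - x v) < \<epsilon>" if "n \<ge> k" for n
    proof -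
      have "\<bar>xs n v - xs n (restrict0 F v)\<bar> \<le> \<epsilon> / 4"
        using le(1)[OF diff_in_V[OF v r], of n] NF functional_diff[OF bf(1)[of n] v r] by linarith
      moreover have "\<bar>x v - x (restrict0 F v)\<bar> \<le> \<epsilon> / 4"
        using le(2)[OF diff_in_V[OF v r]] NF functional_diff[OF bf(2) v r] by linarith
      moreover have "\<bar>xs n (restrict0 F v) - x (restrict0 F v)\<bar> < \<epsilon> / 4" using k that by simp
      ultimately show ?thesis unfolding real_norm_def using e by linarith
    qed
    then show "\<exists>k. \<forall>n\<ge>k. norm (xs n v - x v) < \<epsilon>" by blast
  qed
  then show "limitin (weak_star_ball V N) xs x sequentially"
    unfolding weak_star_ball_def limitin_subtopology limitin_componentwise
    using xs x by (auto simp: dual_ball_iff PiE_def)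
qed

end

section \<open>Weak\<open>\<^sup>*\<close> convergence with convergence of the norms\<close>

context lq_dual_space
begin

text \<open>The \<open>q\<close>-th power of the \<open>q\<close>-norm of the coordinates on
  \<open>A\<close>. For bounded functionals and subsets of \<Gamma> it is additive over disjoint
  index sets, which makes it more convenient than the norm.\<close>

definition mass :: "(('i \<Rightarrow> real) \<Rightarrow> real) \<Rightarrow> 'i set \<Rightarrow> real" where
  "mass \<phi> A = (\<Sum>\<^sub>\<infinity>i\<in>A. \<bar>\<phi> (unit_vec i)\<bar> powr q)"

lemma mass_summable:
  assumes \<phi>: "bounded_functional \<phi>" and A: "A \<subseteq> \<Gamma>"
  shows "(\<lambda>i. \<bar>\<phi> (unit_vec i)\<bar> powr q) summable_on A"
proof (rule nonneg_bdd_above_summable_on)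
  show "bdd_above (sum (\<lambda>i. \<bar>\<phi> (unit_vec i)\<bar> powr q) ` {F. F \<subseteq> A \<and> finite F})"
    using sum_powr_le_dual_norm[OF \<phi>] A by (intro bdd_aboveI2[of _ _ "dual_norm V N \<phi> powr q"]) auto
qed simp

lemma sum_le_mass:
  assumes "bounded_functional \<phi>" "A \<subseteq> \<Gamma>" "finite F" "F \<subseteq> A"
  shows "(\<Sum>i\<in>F. \<bar>\<phi> (unit_vec i)\<bar> powr q) \<le> mass \<phi> A"
  unfolding mass_def using assms by (intro finite_sum_le_infsum mass_summable) auto

lemma mass_le:
  assumes "bounded_functional \<phi>" "A \<subseteq> \<Gamma>"
    and "\<And>F. \<lbrakk>finite F; F \<subseteq> A\<rbrakk> \<Longrightarrow> (\<Sum>i\<in>F. \<bar>\<phi> (unit_vec i)\<bar> powr q) \<le> c"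
  shows "mass \<phi> A \<le> c"
  unfolding mass_def using assms by (intro infsum_le_finite_sums mass_summable) auto

lemma mass_nonneg: "0 \<le> mass \<phi> A"
  unfolding mass_def by (intro infsum_nonneg) auto

lemma mass_cong: "(\<And>i. i \<in> A \<Longrightarrow> \<phi> (unit_vec i) = \<psi> (unit_vec i)) \<Longrightarrow> mass \<phi> A = mass \<psi> A"
  unfolding mass_def by (intro infsum_cong) auto

lemma mass_split:
  assumes \<phi>: "bounded_functional \<phi>" and A: "A \<subseteq> \<Gamma>"
  shows "mass \<phi> \<Gamma> = mass \<phi> A + mass \<phi> (\<Gamma> - A)"
proof -
  have "A \<union> (\<Gamma> - A) = \<Gamma>" using A by auto
  then show ?thesis
    using infsum_Un_disjoint[OF mass_summable[OF \<phi> A] mass_summable[OF \<phi> Diff_subset[of \<Gamma> A]]]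
    by (auto simp: mass_def)
qed

lemma less_mass_obtains:
  assumes \<phi>: "bounded_functional \<phi>" and A: "A \<subseteq> \<Gamma>" and "c < mass \<phi> A"
  obtains F where "finite F" "F \<subseteq> A" "c < (\<Sum>i\<in>F. \<bar>\<phi> (unit_vec i)\<bar> powr q)"
proof -
  have "\<exists>F. finite F \<and> F \<subseteq> A \<and> c < (\<Sum>i\<in>F. \<bar>\<phi> (unit_vec i)\<bar> powr q)"
  proof (rule ccontr)
    assume none: "\<not> ?thesis"
    have "mass \<phi> A \<le> c" by (rule mass_le[OF \<phi> A]) (use none in \<open>meson not_less\<close>)
    with \<open>c < mass \<phi> A\<close> show False by simp
  qed
  then show ?thesis using that by (elim exE conjE)
qed

lemma mass_eq_dual_norm:
  assumes \<phi>: "bounded_functional \<phi>"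
  shows "mass \<phi> \<Gamma> = dual_norm V N \<phi> powr q"
proof (rule antisym)
  show "mass \<phi> \<Gamma> \<le> dual_norm V N \<phi> powr q"
    using sum_powr_le_dual_norm[OF \<phi>] by (intro mass_le \<phi>) auto
  have pow: "(mass \<phi> \<Gamma> powr (1 / q)) powr q = mass \<phi> \<Gamma>"
    using q_ge_1 mass_nonneg by (simp add: powr_powr)
  have "dual_norm V N \<phi> \<le> mass \<phi> \<Gamma> powr (1 / q)"
    using sum_le_mass[OF \<phi> order_refl] by (intro dual_norm_le_of_sums \<phi>) (simp_all only: pow powr_ge_zero)
  then have "dual_norm V N \<phi> powr q \<le> (mass \<phi> \<Gamma> powr (1 / q)) powr q"
    using q_ge_1 dual_norm_nonneg[OF \<phi>] by (intro powr_mono2) auto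
  then show "dual_norm V N \<phi> powr q \<le> mass \<phi> \<Gamma>" unfolding pow .
qed

lemma dual_norm_eq_mass:
  assumes \<phi>: "bounded_functional \<phi>"
  shows "dual_norm V N \<phi> = mass \<phi> \<Gamma> powr (1 / q)"
  unfolding mass_eq_dual_norm[OF \<phi>] using q_ge_1 dual_norm_nonneg[OF \<phi>] by (simp add: powr_powr)

text \<open>The powers \<open>q\<close> and \<open>1 / q\<close> are continuous on the nonnegative
  reals, so convergence of norms may be read as convergence of total masses.\<close>

lemma dual_norm_tendsto_iff:
  assumes xs: "\<And>n. bounded_functional (xs n)" and x: "bounded_functional x"
  shows "(\<lambda>n. dual_norm V N (xs n)) \<longlonglongrightarrow> dual_norm V N x \<longleftrightarrow> (\<lambda>n. mass (xs n) \<Gamma>) \<longlonglongrightarrow> mass x \<Gamma>"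
proof
  assume "(\<lambda>n. dual_norm V N (xs n)) \<longlonglongrightarrow> dual_norm V N x"
  then show "(\<lambda>n. mass (xs n) \<Gamma>) \<longlonglongrightarrow> mass x \<Gamma>"
    unfolding mass_eq_dual_norm[OF xs] mass_eq_dual_norm[OF x]
    using q_ge_1 dual_norm_nonneg[OF xs] by (intro tendsto_powr' tendsto_const) auto
next
  assume "(\<lambda>n. mass (xs n) \<Gamma>) \<longlonglongrightarrow> mass x \<Gamma>"
  then show "(\<lambda>n. dual_norm V N (xs n)) \<longlonglongrightarrow> dual_norm V N x"
    unfolding dual_norm_eq_mass[OF xs] dual_norm_eq_mass[OF x]
    using q_ge_1 mass_nonneg by (intro tendsto_powr' tendsto_const) auto
qed

text \<open>Finitely many coordinates already carry more than \<open>c\<close> of the mass of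
  \<open>x\<close>, and a finite sum follows the coordinates continuously.\<close>

lemma mass_lower_semicontinuous:
  assumes xs: "\<And>n. bounded_functional (xs n)" and x: "bounded_functional x" and A: "A \<subseteq> \<Gamma>"
    and conv: "\<And>i. i \<in> \<Gamma> \<Longrightarrow> (\<lambda>n. xs n (unit_vec i)) \<longlonglongrightarrow> x (unit_vec i)"
    and c: "c < mass x A"
  shows "\<forall>\<^sub>F n in sequentially. c < mass (xs n) A"
proof -
  obtain F where F: "finite F" "F \<subseteq> A" "c < (\<Sum>i\<in>F. \<bar>x (unit_vec i)\<bar> powr q)"
    using less_mass_obtains[OF x A c] .
  have "(\<lambda>n. \<Sum>i\<in>F. \<bar>xs n (unit_vec i)\<bar> powr q) \<longlonglongrightarrow> (\<Sum>i\<in>F. \<bar>x (unit_vec i)\<bar> powr q)"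
    using F A q_ge_1 by (intro tendsto_sum tendsto_powr' tendsto_const tendsto_rabs conv) auto
  then have "\<forall>\<^sub>F n in sequentially. c < (\<Sum>i\<in>F. \<bar>xs n (unit_vec i)\<bar> powr q)"
    using F(3) by (rule order_tendstoD)
  then show ?thesis
    by eventually_elim (use sum_le_mass[OF xs A F(1,2)] in \<open>auto intro: less_le_trans\<close>)
qed

text \<open>The total mass converges and the mass off \<open>A\<close> cannot drop in the limit by
  \<open>mass_lower_semicontinuous\<close>, so no extra mass is left for \<open>A\<close>.\<close>

lemma mass_upper_semicontinuous:
  assumes xs: "\<And>n. bounded_functional (xs n)" and x: "bounded_functional x" and A: "A \<subseteq> \<Gamma>"
    and conv: "\<And>i. i \<in> \<Gamma> \<Longrightarrow> (\<lambda>n. xs n (unit_vec i)) \<longlonglongrightarrow> x (unit_vec i)"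
    and norms: "(\<lambda>n. dual_norm V N (xs n)) \<longlonglongrightarrow> dual_norm V N x"
    and c: "mass x A < c"
  shows "\<forall>\<^sub>F n in sequentially. mass (xs n) A < c"
proof -
  define d where "d = (c - mass x A) / 2"
  have d: "d > 0" using c by (simp add: d_def)
  have "(\<lambda>n. mass (xs n) \<Gamma>) \<longlonglongrightarrow> mass x \<Gamma>" using dual_norm_tendsto_iff[OF xs x] norms by simp
  then have "\<forall>\<^sub>F n in sequentially. mass (xs n) \<Gamma> < mass x \<Gamma> + d"
    using d by (intro order_tendstoD(2)) auto
  moreover have "\<forall>\<^sub>F n in sequentially. mass x (\<Gamma> - A) - d < mass (xs n) (\<Gamma> - A)"
    using d by (intro mass_lower_semicontinuous[OF xs x _ conv]) auto
  ultimately show ?thesis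
  proof eventually_elim
    case (elim n)
    then show ?case
      using mass_split[OF xs[of n] A] mass_split[OF x A] unfolding d_def by (simp add: field_simps)
  qed
qed

lemma abs_diff_powr_le:
  fixes u v :: real
  shows "\<bar>u - v\<bar> powr q \<le> 2 powr q * (\<bar>u\<bar> powr q + \<bar>v\<bar> powr q)"
proof -
  have "\<bar>u - v\<bar> powr q \<le> (2 * max \<bar>u\<bar> \<bar>v\<bar>) powr q"
    using q_ge_1 by (intro powr_mono2) auto
  also have "\<dots> = 2 powr q * max \<bar>u\<bar> \<bar>v\<bar> powr q" by (rule powr_mult)
  also have "\<dots> \<le> 2 powr q * (\<bar>u\<bar> powr q + \<bar>v\<bar> powr q)"
    by (intro mult_left_mono) (simp_all add: max_def)
  finally show ?thesis .
qed

text \<open>The Kadec--Klee property of \<open>\<ell>\<^sub>q\<close>: the mass carried off a large finite set cannot grow.\<close>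

lemma dual_norm_diff_tendsto_0:
  assumes xs: "\<And>n. bounded_functional (xs n)" and x: "bounded_functional x"
    and conv: "\<And>i. i \<in> \<Gamma> \<Longrightarrow> (\<lambda>n. xs n (unit_vec i)) \<longlonglongrightarrow> x (unit_vec i)"
    and norms: "(\<lambda>n. dual_norm V N (xs n)) \<longlonglongrightarrow> dual_norm V N x"
  shows "(\<lambda>n. dual_norm V N (\<lambda>v. xs n v - x v)) \<longlonglongrightarrow> 0"
proof (rule LIMSEQ_I)
  fix \<delta> :: real assume "\<delta> > 0"
  \<comment> \<open>Error budget in units of \<epsilon>: 1 for the coordinates in \<open>F\<close>,
    and 4 under the factor \<open>2 powr q\<close> for those off \<open>F\<close>, where
    \<open>xs n\<close> has mass below \<open>3 * \<epsilon>\<close> and \<open>x\<close> below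
    \<epsilon>. The choice of \<epsilon> makes the total
    \<open>(\<delta> / 2) powr q\<close>.\<close>
  define K :: real where "K = 1 + 2 powr q * 4"
  define \<epsilon> where "\<epsilon> = (\<delta> / 2) powr q / K"
  have K: "K > 0" unfolding K_def by (simp add: add_pos_nonneg)
  have e: "\<epsilon> > 0" using K \<open>\<delta> > 0\<close> by (simp add: \<epsilon>_def)
  have "mass x \<Gamma> - \<epsilon> < mass x \<Gamma>" using e by simp
  then obtain F where F: "finite F" "F \<subseteq> \<Gamma>"
    and Fx: "mass x \<Gamma> - \<epsilon> < (\<Sum>i\<in>F. \<bar>x (unit_vec i)\<bar> powr q)"
    using less_mass_obtains[OF x order_refl] by blast
  have "(\<lambda>n. mass (xs n) \<Gamma>) \<longlonglongrightarrow> mass x \<Gamma>" using dual_norm_tendsto_iff[OF xs x] norms by simp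
  then have "\<forall>\<^sub>F n in sequentially. mass (xs n) \<Gamma> < mass x \<Gamma> + \<epsilon>"
    using e by (intro order_tendstoD(2)) auto
  moreover have "(\<lambda>n. \<Sum>i\<in>F. \<bar>xs n (unit_vec i)\<bar> powr q) \<longlonglongrightarrow> (\<Sum>i\<in>F. \<bar>x (unit_vec i)\<bar> powr q)"
    using F q_ge_1 by (intro tendsto_sum tendsto_powr' tendsto_const tendsto_rabs conv) auto
  then have "\<forall>\<^sub>F n in sequentially.
      (\<Sum>i\<in>F. \<bar>x (unit_vec i)\<bar> powr q) - \<epsilon> < (\<Sum>i\<in>F. \<bar>xs n (unit_vec i)\<bar> powr q)"
    using e by (intro order_tendstoD(1)) auto
  moreover have "(\<lambda>n. \<Sum>i\<in>F. \<bar>xs n (unit_vec i) - x (unit_vec i)\<bar> powr q) \<longlonglongrightarrow>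
      (\<Sum>i\<in>F. \<bar>x (unit_vec i) - x (unit_vec i)\<bar> powr q)"
    using F q_ge_1
    by (intro tendsto_sum tendsto_powr' tendsto_const tendsto_rabs tendsto_diff conv) auto
  then have "\<forall>\<^sub>F n in sequentially. (\<Sum>i\<in>F. \<bar>xs n (unit_vec i) - x (unit_vec i)\<bar> powr q) < \<epsilon>"
    using e by (intro order_tendstoD(2)) auto
  ultimately have "\<forall>\<^sub>F n in sequentially. norm (dual_norm V N (\<lambda>v. xs n v - x v) - 0) < \<delta>"
  proof eventually_elim
    case (elim n)
    let ?d = "\<lambda>v. xs n v - x v"
    have d: "bounded_functional ?d" by (rule bounded_functional_minus[OF xs x])
    have "dual_norm V N ?d \<le> \<delta> / 2"
    proof (rule dual_norm_le_of_sums[OF d])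
      fix H assume H: "finite H" "H \<subseteq> \<Gamma>"
      have tail: "(\<Sum>i\<in>H - F. \<bar>\<phi> (unit_vec i)\<bar> powr q) \<le>
          mass \<phi> \<Gamma> - (\<Sum>i\<in>F. \<bar>\<phi> (unit_vec i)\<bar> powr q)" if "bounded_functional \<phi>" for \<phi>
      proof -
        have "(\<Sum>i\<in>(H - F) \<union> F. \<bar>\<phi> (unit_vec i)\<bar> powr q) \<le> mass \<phi> \<Gamma>"
          using H F by (intro sum_le_mass that) auto
        also have "(\<Sum>i\<in>(H - F) \<union> F. \<bar>\<phi> (unit_vec i)\<bar> powr q) =
            (\<Sum>i\<in>H - F. \<bar>\<phi> (unit_vec i)\<bar> powr q) + (\<Sum>i\<in>F. \<bar>\<phi> (unit_vec i)\<bar> powr q)"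
          using H F by (intro sum.union_disjoint) auto
        finally show ?thesis by simp
      qed
      have "(\<Sum>i\<in>H. \<bar>?d (unit_vec i)\<bar> powr q) \<le> (\<Sum>i\<in>(H - F) \<union> F. \<bar>?d (unit_vec i)\<bar> powr q)"
        using H F by (intro sum_mono2) auto
      also have "\<dots> = (\<Sum>i\<in>H - F. \<bar>?d (unit_vec i)\<bar> powr q) + (\<Sum>i\<in>F. \<bar>?d (unit_vec i)\<bar> powr q)"
        using H F by (intro sum.union_disjoint) auto
      also have "\<dots> \<le> 2 powr q * (4 * \<epsilon>) + \<epsilon>"
      proof (rule add_mono)
        have "(\<Sum>i\<in>H - F. \<bar>?d (unit_vec i)\<bar> powr q) \<le>
            (\<Sum>i\<in>H - F. 2 powr q * (\<bar>xs n (unit_vec i)\<bar> powr q + \<bar>x (unit_vec i)\<bar> powr q))"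
          by (intro sum_mono abs_diff_powr_le)
        also have "\<dots> = 2 powr q * ((\<Sum>i\<in>H - F. \<bar>xs n (unit_vec i)\<bar> powr q) +
            (\<Sum>i\<in>H - F. \<bar>x (unit_vec i)\<bar> powr q))"
          unfolding sum.distrib[symmetric] sum_distrib_left by (rule refl)
        also have "\<dots> \<le> 2 powr q * (4 * \<epsilon>)"
          using tail[OF xs[of n]] tail[OF x] elim(1,2) Fx by (intro mult_left_mono) auto
        finally show "(\<Sum>i\<in>H - F. \<bar>?d (unit_vec i)\<bar> powr q) \<le> 2 powr q * (4 * \<epsilon>)" .
        show "(\<Sum>i\<in>F. \<bar>?d (unit_vec i)\<bar> powr q) \<le> \<epsilon>" using elim(3) by simp
      qed
      also have "\<dots> = K * \<epsilon>" by (simp add: K_def algebra_simps)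
      also have "\<dots> = (\<delta> / 2) powr q" using K by (simp add: \<epsilon>_def)
      finally show "(\<Sum>i\<in>H. \<bar>?d (unit_vec i)\<bar> powr q) \<le> (\<delta> / 2) powr q" .
    qed (use \<open>\<delta> > 0\<close> in simp)
    then show ?case using dual_norm_nonneg[OF d] \<open>\<delta> > 0\<close> by simp
  qed
  then show "\<exists>k. \<forall>n\<ge>k. norm (dual_norm V N (\<lambda>v. xs n v - x v) - 0) < \<delta>"
    unfolding eventually_sequentially .
qed

text \<open>Shows that the two classes ask for the same sequences here. Norm convergence passes to
  coordinates and, by the triangle inequality, to norms; the converse is the Kadec-Klee
  property.\<close>

lemma norm_convergent_iff:
  assumes xs: "\<And>n. xs n \<in> dual_ball V N" and x: "x \<in> dual_ball V N"
  shows "(\<lambda>n. dual_norm V N (\<lambda>v. xs n v - x v)) \<longlonglongrightarrow> 0 \<longleftrightarrow>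
    limitin (weak_star_ball V N) xs x sequentially \<and>
    (\<lambda>n. dual_norm V N (xs n)) \<longlonglongrightarrow> dual_norm V N x"
proof -
  have bf: "bounded_functional (xs n)" "bounded_functional x" for n
    using xs x by (auto simp: dual_ball_iff)
  have d: "bounded_functional (\<lambda>v. xs n v - x v)" for n by (rule bounded_functional_minus[OF bf])
  show ?thesis
  proof (intro iffI conjI)
    assume L: "(\<lambda>n. dual_norm V N (\<lambda>v. xs n v - x v)) \<longlonglongrightarrow> 0"
    have "(\<lambda>n. xs n (unit_vec i)) \<longlonglongrightarrow> x (unit_vec i)" if "i \<in> \<Gamma>" for i
    proof (rule Lim_null[THEN iffD2], rule Lim_null_comparison)
      have "(\<lambda>n. dual_norm V N (\<lambda>v. xs n v - x v) * N (unit_vec i)) \<longlonglongrightarrow> 0 * N (unit_vec i)"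
        by (intro tendsto_mult L tendsto_const)
      then show "(\<lambda>n. dual_norm V N (\<lambda>v. xs n v - x v) * N (unit_vec i)) \<longlonglongrightarrow> 0" by simp
      show "\<forall>\<^sub>F n in sequentially. norm (xs n (unit_vec i) - x (unit_vec i)) \<le>
          dual_norm V N (\<lambda>v. xs n v - x v) * N (unit_vec i)"
        using abs_le_dual_norm[OF d unit_vec_in_V[OF that]] by simp
    qed
    then show "limitin (weak_star_ball V N) xs x sequentially"
      unfolding limitin_weak_star_ball_iff[OF xs x] by blast
    show "(\<lambda>n. dual_norm V N (xs n)) \<longlonglongrightarrow> dual_norm V N x"
    proof (rule Lim_null[THEN iffD2], rule Lim_null_comparison[OF _ L], rule always_eventually, rule allI)
      fix n
      let ?D = "dual_norm V N (\<lambda>v. xs n v - x v)"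
      have 1: "\<bar>xs n f - x f\<bar> \<le> ?D" if "f \<in> V" "N f \<le> 1" for f
        using abs_le_dual_norm_unit[OF d[of n] that] .
      have "dual_norm V N (xs n) \<le> dual_norm V N x + ?D"
      proof (rule dual_norm_le)
        fix f assume f: "f \<in> V" "N f \<le> 1"
        show "\<bar>xs n f\<bar> \<le> dual_norm V N x + ?D"
          using 1[OF f] abs_le_dual_norm_unit[OF bf(2) f] by linarith
      qed
      moreover have "dual_norm V N x \<le> dual_norm V N (xs n) + ?D"
      proof (rule dual_norm_le)
        fix f assume f: "f \<in> V" "N f \<le> 1"
        show "\<bar>x f\<bar> \<le> dual_norm V N (xs n) + ?D"
          using 1[OF f] abs_le_dual_norm_unit[OF bf(1)[of n] f] by linarith
      qed
      ultimately show "norm (dual_norm V N (xs n) - dual_norm V N x) \<le> ?D" by simp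
    qed
  next
    assume R: "limitin (weak_star_ball V N) xs x sequentially \<and>
      (\<lambda>n. dual_norm V N (xs n)) \<longlonglongrightarrow> dual_norm V N x"
    then show "(\<lambda>n. dual_norm V N (\<lambda>v. xs n v - x v)) \<longlonglongrightarrow> 0"
      using limitin_weak_star_ball_iff[OF xs x] by (intro dual_norm_diff_tendsto_0 bf) auto
  qed
qed

text \<open>From here on \<open>coords.agree A\<close> is the quotient of the dual ball given by
  restriction to the coordinates in \<open>A\<close>.\<close>

sublocale coords: compact_coordinates "weak_star_ball V N" \<Gamma> "\<lambda>i \<phi>. \<phi> (unit_vec i)"
proof
  show "compact_space (weak_star_ball V N)" by (rule compact_space_weak_star_ball)
  show "continuous_map (weak_star_ball V N) euclideanreal (\<lambda>\<phi>. \<phi> (unit_vec i))" if "i \<in> \<Gamma>" for i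
    by (rule continuous_map_evaluation[OF unit_vec_in_V[OF that]])
  show "\<phi> = \<psi>" if "\<phi> \<in> topspace (weak_star_ball V N)" "\<psi> \<in> topspace (weak_star_ball V N)"
    "\<And>i. i \<in> \<Gamma> \<Longrightarrow> \<phi> (unit_vec i) = \<psi> (unit_vec i)" for \<phi> \<psi>
    using that by (intro dual_space_eqI) (auto simp: topspace_weak_star_ball dual_ball_def)
qed

text \<open>A countable \<open>A\<close> misses some index \<open>i\<close>, and the functional with
  single coordinate 1 at \<open>i\<close> agrees with the zero functional on
  \<open>A\<close>.\<close>

lemma not_countable_weight: "\<not> countable_weight (weak_star_ball V N)"
proof (rule coords.not_countable_weightI)
  fix A assume A: "countable A" "A \<subseteq> \<Gamma>"
  then obtain i where i: "i \<in> \<Gamma>" "i \<notin> A"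
    using uncountable_index by (metis subsetI countable_subset)
  have "(\<Sum>j\<in>F. \<bar>if j = i then 1 else 0\<bar> powr q) \<le> (1 :: real)" if F: "finite F" for F
  proof -
    have "(\<Sum>j\<in>F. \<bar>if j = i then 1 else 0\<bar> powr q) = (\<Sum>j\<in>F. if j = i then 1 else 0 :: real)"
      by (intro sum.cong) auto
    then show ?thesis using F by (simp add: sum.delta')
  qed
  from dual_ball_with_coordinates[OF this]
  obtain \<phi> where \<phi>: "\<phi> \<in> dual_ball V N"
    and \<phi>c: "\<And>j. j \<in> \<Gamma> \<Longrightarrow> \<phi> (unit_vec j) = (if j = i then 1 else 0)" by blast
  obtain \<psi> where \<psi>: "\<psi> \<in> dual_ball V N" and \<psi>c: "\<And>j. j \<in> \<Gamma> \<Longrightarrow> \<psi> (unit_vec j) = 0"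
    using dual_ball_with_coordinates[of "\<lambda>_. 0"] by auto
  have "(\<phi>, \<psi>) \<in> coords.agree A"
    using \<phi> \<psi> \<phi>c \<psi>c A i by (auto simp: coords.agree_def topspace_weak_star_ball)
  moreover have "\<phi> \<noteq> \<psi>" using \<phi>c[OF i(1)] \<psi>c[OF i(1)] by auto
  ultimately show "\<exists>x y. (x, y) \<in> coords.agree A \<and> x \<noteq> y" by blast
qed

end

section \<open>Fiber convergence in the dual ball\<close>

lemma limitin_quotient_projection:
  assumes "limitin K xs x F"
  shows "limitin (quotient_space K E) (\<lambda>n. E `` {xs n}) (E `` {x}) F"
  using continuous_map_limit[OF continuous_map_quotient_projection assms] by (simp add: o_def)

context lq_dual_space
begin

text \<open>Such a \<open>y\<close> has mass at most \<open>1 - mass x A\<close> off \<open>A\<close>; scaling that part by \<open>t n \<le> 1\<close>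
  makes room for the mass of \<open>xs n\<close> on \<open>A\<close>.\<close>

lemma lift_convergent_sequence:
  assumes xs: "\<And>n. xs n \<in> dual_ball V N" and x: "x \<in> dual_ball V N"
    and lim: "limitin (weak_star_ball V N) xs x sequentially"
    and norms: "(\<lambda>n. dual_norm V N (xs n)) \<longlonglongrightarrow> dual_norm V N x"
    and A: "A \<subseteq> \<Gamma>" and y: "y \<in> dual_ball V N"
    and agree: "\<And>i. i \<in> A \<Longrightarrow> y (unit_vec i) = x (unit_vec i)"
  shows "\<exists>ys. (\<forall>n. ys n \<in> dual_ball V N \<and> (\<forall>i\<in>A. ys n (unit_vec i) = xs n (unit_vec i))) \<and>
    limitin (weak_star_ball V N) ys y sequentially"
proof -
  have bf: "bounded_functional (xs n)" "bounded_functional x" "bounded_functional y" for n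
    using xs x y by (auto simp: dual_ball_iff)
  have conv: "(\<lambda>n. xs n (unit_vec i)) \<longlonglongrightarrow> x (unit_vec i)" if "i \<in> \<Gamma>" for i
    using lim that unfolding limitin_weak_star_ball_iff[OF xs x] by blast
  define b where "b = mass y (\<Gamma> - A)"
  have b0: "0 \<le> b" by (simp add: b_def mass_nonneg)
  have mass1: "mass \<phi> B \<le> 1" if "\<phi> \<in> dual_ball V N" "B \<subseteq> \<Gamma>" for \<phi> B
    using that dual_ball_sum_le_1[OF that(1)] by (intro mass_le) (auto simp: dual_ball_iff)
  have "mass x A + b = mass y \<Gamma>"
    unfolding b_def mass_split[OF bf(3) A] using mass_cong[of A y x] agree by simp
  then have xb: "mass x A + b \<le> 1" using mass1[OF y order_refl] by simp
  \<comment> \<open>\<open>u n\<close> is the \<open>q\<close>-th power of the scaling factor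
    \<open>t n\<close>: scaling turns the mass \<open>b\<close> of \<open>y\<close> off
    \<open>A\<close> into \<open>u n * b\<close>, and the second entry of the minimum is exactly
    what makes the total mass 1. If \<open>b = 0\<close> there is nothing to scale.\<close>
  define u where "u n = (if b = 0 then 1 else min 1 ((1 - mass (xs n) A) / b))" for n
  have u01: "0 \<le> u n" "u n \<le> 1" for n
    using mass1[OF xs A, of n] b0 by (auto simp: u_def)
  have ub: "mass (xs n) A + u n * b \<le> 1" for n
  proof (cases "b = 0")
    case True
    then show ?thesis using mass1[OF xs A] by simp
  next
    case False
    then have "u n * b \<le> (1 - mass (xs n) A) / b * b"
      unfolding u_def using b0 by (intro mult_right_mono) auto
    then show ?thesis using False by simp
  qed
  have u_lim: "u \<longlonglongrightarrow> 1"
  proof (cases "b = 0")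
    case True
    then have "u = (\<lambda>_. 1)" by (auto simp: u_def)
    then show ?thesis by simp
  next
    case False
    then have b: "b > 0" using b0 by simp
    show ?thesis
    proof (rule order_tendstoI)
      fix a :: real assume a: "a < 1"
      \<comment> \<open>For \<open>a < 1\<close> the condition \<open>a < u n\<close> reduces to
        \<open>mass (xs n) A < 1 - a * b\<close>. The limit satisfies it strictly because
        \<open>mass x A \<le> 1 - b\<close>, so upper semicontinuity applies.\<close>
      have "a * b < 1 * b" using a b by (intro mult_strict_right_mono)
      then have "mass x A < 1 - a * b" using xb by simp
      then have "\<forall>\<^sub>F n in sequentially. mass (xs n) A < 1 - a * b"
        by (intro mass_upper_semicontinuous[OF bf(1,2) A conv norms])
      then show "\<forall>\<^sub>F n in sequentially. a < u n"
      proof eventually_elim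
        case (elim n)
        then have "a < (1 - mass (xs n) A) / b" using b by (simp add: field_simps)
        then show ?case using a by (simp add: u_def)
      qed
    next
      fix a :: real assume "1 < a"
      then have "u n < a" for n using u01(2)[of n] by simp
      then show "\<forall>\<^sub>F n in sequentially. u n < a" by simp
    qed
  qed
  define t where "t n = u n powr (1 / q)" for n
  have t_pow: "t n powr q = u n" for n
    using u01(1)[of n] q_ge_1 by (simp add: t_def powr_powr)
  have "(\<lambda>n. u n powr (1 / q)) \<longlonglongrightarrow> 1 powr (1 / q)"
    using u_lim by (intro tendsto_powr tendsto_const) auto
  then have t_lim: "t \<longlonglongrightarrow> 1" by (simp add: t_def[abs_def])
  define a where "a n i = (if i \<in> A then xs n (unit_vec i) else t n * y (unit_vec i))" for n i
  have sums: "(\<Sum>i\<in>F. \<bar>a n i\<bar> powr q) \<le> 1" if F: "finite F" "F \<subseteq> \<Gamma>" for n F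
  proof -
    have "(\<Sum>i\<in>F. \<bar>a n i\<bar> powr q) = (\<Sum>i\<in>F \<inter> A. \<bar>a n i\<bar> powr q) + (\<Sum>i\<in>F - A. \<bar>a n i\<bar> powr q)"
      using F(1) by (metis sum.Int_Diff)
    also have "(\<Sum>i\<in>F \<inter> A. \<bar>a n i\<bar> powr q) = (\<Sum>i\<in>F \<inter> A. \<bar>xs n (unit_vec i)\<bar> powr q)"
      by (intro sum.cong) (auto simp: a_def)
    also have "(\<Sum>i\<in>F - A. \<bar>a n i\<bar> powr q) = (\<Sum>i\<in>F - A. u n * \<bar>y (unit_vec i)\<bar> powr q)"
      unfolding t_pow[symmetric] using t_def
      by (intro sum.cong) (auto simp: a_def abs_mult powr_mult)
    also have "\<dots> = u n * (\<Sum>i\<in>F - A. \<bar>y (unit_vec i)\<bar> powr q)"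
      by (simp add: sum_distrib_left)
    also have "(\<Sum>i\<in>F \<inter> A. \<bar>xs n (unit_vec i)\<bar> powr q) \<le> mass (xs n) A"
      using F by (intro sum_le_mass bf A) auto
    also have "u n * (\<Sum>i\<in>F - A. \<bar>y (unit_vec i)\<bar> powr q) \<le> u n * b"
      unfolding b_def using F u01 by (intro mult_left_mono sum_le_mass bf) auto
    also note ub
    finally show ?thesis by simp
  qed
  have "\<forall>n. \<exists>\<phi>. \<phi> \<in> dual_ball V N \<and> (\<forall>i\<in>\<Gamma>. \<phi> (unit_vec i) = a n i)"
  proof
    fix n
    show "\<exists>\<phi>. \<phi> \<in> dual_ball V N \<and> (\<forall>i\<in>\<Gamma>. \<phi> (unit_vec i) = a n i)"
    proof (rule dual_ball_with_coordinates[of "a n"])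
      show "(\<Sum>i\<in>F. \<bar>a n i\<bar> powr q) \<le> 1" if "finite F" "F \<subseteq> \<Gamma>" for F
        using that by (rule sums)
      show ?thesis if "\<phi> \<in> dual_ball V N" "\<And>i. i \<in> \<Gamma> \<Longrightarrow> \<phi> (unit_vec i) = a n i" for \<phi>
        using that by (intro exI[of _ \<phi>]) simp
    qed
  qed
  from choice[OF this] obtain ys
    where "\<forall>n. ys n \<in> dual_ball V N \<and> (\<forall>i\<in>\<Gamma>. ys n (unit_vec i) = a n i)" by (elim exE)
  then have ys: "\<And>n. ys n \<in> dual_ball V N"
    and ysa: "\<And>n i. i \<in> \<Gamma> \<Longrightarrow> ys n (unit_vec i) = a n i" by simp_all
  have "(\<lambda>n. ys n (unit_vec i)) \<longlonglongrightarrow> y (unit_vec i)" if i: "i \<in> \<Gamma>" for i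
  proof (cases "i \<in> A")
    case True
    then show ?thesis using conv[OF i] by (simp add: ysa[OF i] a_def agree)
  next
    case False
    have "(\<lambda>n. t n * y (unit_vec i)) \<longlonglongrightarrow> 1 * y (unit_vec i)"
      by (intro tendsto_mult t_lim tendsto_const)
    then show ?thesis using False by (simp add: ysa[OF i] a_def)
  qed
  then have "limitin (weak_star_ball V N) ys y sequentially"
    unfolding limitin_weak_star_ball_iff[OF ys y] by blast
  moreover have "ys n (unit_vec i) = xs n (unit_vec i)" if "i \<in> A" for n i
    using that A ysa[of i] by (auto simp: a_def)
  ultimately show ?thesis using ys by (intro exI[of _ ys]) simp
qed

text \<open>The witness is the semilattice of all countable restrictions. Lifts are built in the
  ball itself, prescribed on the coordinates of the coarser quotient \<open>E'\<close>, and then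
  projected to \<open>E\<close>.\<close>

lemma fiber_convergentI:
  assumes xs: "\<And>n. xs n \<in> dual_ball V N" and x: "x \<in> dual_ball V N"
    and lim: "limitin (weak_star_ball V N) xs x sequentially"
    and norms: "(\<lambda>n. dual_norm V N (xs n)) \<longlonglongrightarrow> dual_norm V N x"
  shows "fiber_convergent (weak_star_ball V N) xs"
proof -
  let ?K = "weak_star_ball V N"
  have "map_fiber_convergent (quotient_space ?K E) (quotient_space ?K E') \<pi>
      (\<lambda>n. E' `` {xs n}) (E' `` {x})"
    if E: "E \<in> coords.countable_agree" and E': "E' \<in> coords.countable_agree"
      and \<pi>: "natural_projection ?K E E' \<pi>" for E E' \<pi>
  proof -
    obtain A where A: "A \<subseteq> \<Gamma>" "E' = coords.agree A"
      using E' unfolding coords.countable_agree_def by blast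
    have \<pi>x: "\<pi> (E `` {z}) = E' `` {z}" if "z \<in> dual_ball V N" for z
      using \<pi> that unfolding natural_projection_def topspace_weak_star_ball by blast
    have agree: "E' `` {z} = E' `` {w} \<longleftrightarrow> (\<forall>i\<in>A. z (unit_vec i) = w (unit_vec i))"
      if "z \<in> dual_ball V N" "w \<in> dual_ball V N" for z w
      unfolding A(2) using that by (intro coords.agree_class_eq_iff) (simp_all add: topspace_weak_star_ball)
    have lift: "\<exists>ys. (\<forall>n. ys n \<in> topspace (quotient_space ?K E) \<and> \<pi> (ys n) = E' `` {xs n}) \<and>
        limitin (quotient_space ?K E) ys c sequentially"
      if c: "c \<in> topspace (quotient_space ?K E)" "\<pi> c = E' `` {x}" for c
    proof -
      obtain y where y: "y \<in> dual_ball V N" "c = E `` {y}"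
        using c(1) unfolding topspace_quotient_space topspace_weak_star_ball by (rule quotientE)
      have "\<forall>i\<in>A. y (unit_vec i) = x (unit_vec i)"
        using c(2) \<pi>x[OF y(1)] agree[OF y(1) x] y(2) by simp
      then obtain zs where zs: "\<And>n. zs n \<in> dual_ball V N"
        "\<And>n. \<forall>i\<in>A. zs n (unit_vec i) = xs n (unit_vec i)" "limitin ?K zs y sequentially"
        using lift_convergent_sequence[OF xs x lim norms A(1) y(1)] by auto
      have "E `` {zs n} \<in> topspace (quotient_space ?K E)" for n
        using zs(1) by (simp add: topspace_quotient_space topspace_weak_star_ball quotientI)
      moreover have "\<pi> (E `` {zs n}) = E' `` {xs n}" for n
        using \<pi>x[OF zs(1)] agree[OF zs(1) xs] zs(2) by simp
      moreover have "limitin (quotient_space ?K E) (\<lambda>n. E `` {zs n}) c sequentially"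
        unfolding y(2) by (rule limitin_quotient_projection[OF zs(3)])
      ultimately show ?thesis by (intro exI[of _ "\<lambda>n. E `` {zs n}"]) simp
    qed
    have "E' `` {xs n} \<in> topspace (quotient_space ?K E')" for n
      using xs by (simp add: topspace_quotient_space topspace_weak_star_ball quotientI)
    then show ?thesis
      using \<pi> lift limitin_quotient_projection[OF lim]
      unfolding map_fiber_convergent_def natural_projection_def by simp
  qed
  then have "\<exists>x. limitin ?K xs x sequentially \<and>
      (\<exists>\<S>. cofinal_family ?K \<S> \<and> sigma_semilattice ?K \<S> \<and>
        (\<forall>E\<in>\<S>. \<forall>E'\<in>\<S>. \<forall>\<pi>. quotient_le ?K E' E \<and> natural_projection ?K E E' \<pi> \<longrightarrow>
          map_fiber_convergent (quotient_space ?K E) (quotient_space ?K E') \<pi>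
            (\<lambda>n. E' `` {xs n}) (E' `` {x})))"
    using lim coords.cofinal_family_countable_agree coords.sigma_semilattice_countable_agree
    by (intro exI[of _ x] exI[of _ coords.countable_agree] conjI) simp_all
  then show ?thesis
    unfolding fiber_convergent_def
    using compact_space_weak_star_ball coords.Hausdorff_space not_countable_weight xs
    by (simp add: topspace_weak_star_ball)
qed

lemma countable_support:
  assumes "bounded_functional \<phi>"
  shows "countable {i \<in> \<Gamma>. \<phi> (unit_vec i) \<noteq> 0}"
proof -
  have "countable {i \<in> \<Gamma>. \<bar>\<phi> (unit_vec i)\<bar> powr q \<noteq> 0}"
    by (rule summable_countable_real[OF mass_summable[OF assms order_refl]])
  then show ?thesis by simp
qed

text \<open>Choose \<open>agree A\<close> in the semilattice with \<open>A\<close> carrying all the functionals, and a larger \<open>agree B\<close>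
  with \<open>i \<in> B - A\<close>. The point \<open>x + c e\<^sub>i\<close> of norm one lies over \<open>x\<close>, and lifting the
  sequence to it forces \<open>mass (xs n) \<Gamma> \<le> 1 - \<bar>zs n (unit_vec i)\<bar> powr q\<close>, which tends to
  \<open>mass x \<Gamma>\<close>.\<close>

lemma fiber_convergentD:
  assumes xs: "\<And>n. xs n \<in> dual_ball V N" and fc: "fiber_convergent (weak_star_ball V N) xs"
  obtains x where "x \<in> dual_ball V N" "limitin (weak_star_ball V N) xs x sequentially"
    "(\<lambda>n. dual_norm V N (xs n)) \<longlonglongrightarrow> dual_norm V N x"
proof -
  let ?K = "weak_star_ball V N"
  obtain x \<S> where lim: "limitin ?K xs x sequentially"
    and S: "cofinal_family ?K \<S>" "sigma_semilattice ?K \<S>"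
    and fib: "\<forall>E\<in>\<S>. \<forall>E'\<in>\<S>. \<forall>\<pi>. quotient_le ?K E' E \<and> natural_projection ?K E E' \<pi> \<longrightarrow>
      map_fiber_convergent (quotient_space ?K E) (quotient_space ?K E') \<pi>
        (\<lambda>n. E' `` {xs n}) (E' `` {x})"
    using fc unfolding fiber_convergent_def by (elim conjE exE)
  have x: "x \<in> dual_ball V N" using limitin_topspace[OF lim] by (simp add: topspace_weak_star_ball)
  have bf: "bounded_functional (xs n)" "bounded_functional x" for n
    using xs x by (auto simp: dual_ball_iff)
  have conv: "(\<lambda>n. xs n (unit_vec i)) \<longlonglongrightarrow> x (unit_vec i)" if "i \<in> \<Gamma>" for i
    using lim that unfolding limitin_weak_star_ball_iff[OF xs x] by blast
  \<comment> \<open>Collecting all supports ensures that \<open>x\<close> and every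
    \<open>xs n\<close> vanish off \<open>A\<close>, so that a lift agreeing with
    \<open>xs n\<close> on \<open>A\<close> carries all of its mass.\<close>
  define A0 where "A0 = {i \<in> \<Gamma>. x (unit_vec i) \<noteq> 0} \<union> (\<Union>n. {i \<in> \<Gamma>. xs n (unit_vec i) \<noteq> 0})"
  have A0: "countable A0" "A0 \<subseteq> \<Gamma>"
    unfolding A0_def using countable_support[OF bf(2)] countable_support[OF bf(1)] by auto
  obtain A where A: "A0 \<subseteq> A" "countable A" "A \<subseteq> \<Gamma>" "coords.agree A \<in> \<S>"
    by (rule coords.sigma_semilattice_contains_agree[OF S A0])
  have xs0: "xs n (unit_vec i) = 0" and x0: "x (unit_vec i) = 0" if "i \<in> \<Gamma> - A" for n i
    using that A(1) unfolding A0_def by auto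
  obtain i where i: "i \<in> \<Gamma>" "i \<notin> A"
    using uncountable_index A(2) by (metis subsetI countable_subset)
  have "countable (insert i A)" "insert i A \<subseteq> \<Gamma>" using A i by auto
  then obtain B where B: "insert i A \<subseteq> B" "countable B" "B \<subseteq> \<Gamma>" "coords.agree B \<in> \<S>"
    by (rule coords.sigma_semilattice_contains_agree[OF S])
  let ?E = "coords.agree B" and ?E' = "coords.agree A"
  have "?E \<subseteq> ?E'" using B(1) by (auto simp: coords.agree_def)
  then have le: "quotient_le ?K ?E' ?E"
    by (simp add: quotient_le_iff coords.equiv_agree)
  then obtain \<pi> where \<pi>: "natural_projection ?K ?E ?E' \<pi>" unfolding quotient_le_def by (elim exE)
  then have \<pi>x: "\<pi> (?E `` {z}) = ?E' `` {z}" if "z \<in> dual_ball V N" for z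
    using that unfolding natural_projection_def topspace_weak_star_ball by blast
  have mfc: "map_fiber_convergent (quotient_space ?K ?E) (quotient_space ?K ?E') \<pi>
      (\<lambda>n. ?E' `` {xs n}) (?E' `` {x})" using fib A(4) B(4) le \<pi> by blast
  define m where "m = mass x \<Gamma>"
  have m: "0 \<le> m" "m \<le> 1"
    unfolding m_def using mass_nonneg dual_ball_sum_le_1[OF x] bf by (auto intro: mass_le)
  \<comment> \<open>Since \<open>x\<close> vanishes at \<open>i\<close>, the entry \<open>c\<close>
    there raises the mass from \<open>m\<close> to exactly 1.\<close>
  define c where "c = (1 - m) powr (1 / q)"
  have c: "c powr q = 1 - m" "0 \<le> c" using m q_ge_1 by (auto simp: c_def powr_powr)
  have "(\<Sum>j\<in>F. \<bar>if j = i then c else x (unit_vec j)\<bar> powr q) \<le> 1" if F: "finite F" "F \<subseteq> \<Gamma>" for F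
  proof -
    let ?g = "\<lambda>j. \<bar>if j = i then c else x (unit_vec j)\<bar> powr q"
    have "sum ?g F \<le> sum ?g (insert i F)" using F by (intro sum_mono2) auto
    also have "\<dots> = ?g i + sum ?g (F - {i})" using F by (simp add: sum.insert_remove)
    also have "sum ?g (F - {i}) = (\<Sum>j\<in>F - {i}. \<bar>x (unit_vec j)\<bar> powr q)"
      by (intro sum.cong) auto
    also have "\<dots> \<le> m" unfolding m_def using F bf by (intro sum_le_mass) auto
    finally show ?thesis using c by simp
  qed
  from dual_ball_with_coordinates[OF this]
  obtain y where y: "y \<in> dual_ball V N"
    and yc: "\<And>j. j \<in> \<Gamma> \<Longrightarrow> y (unit_vec j) = (if j = i then c else x (unit_vec j))" by auto
  have "?E' `` {y} = ?E' `` {x}"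
    using y x yc A(3) i by (subst coords.agree_class_eq_iff) (auto simp: topspace_weak_star_ball)
  then have "\<pi> (?E `` {y}) = ?E' `` {x}" using \<pi>x[OF y] by simp
  moreover have "?E `` {y} \<in> topspace (quotient_space ?K ?E)"
    using y by (simp add: topspace_quotient_space topspace_weak_star_ball quotientI)
  ultimately obtain ys where ys: "\<forall>n. ys n \<in> topspace (quotient_space ?K ?E) \<and> \<pi> (ys n) = ?E' `` {xs n}"
    and ys_lim: "limitin (quotient_space ?K ?E) ys (?E `` {y}) sequentially"
    using mfc unfolding map_fiber_convergent_def by meson
  have "\<forall>n. \<exists>z. z \<in> dual_ball V N \<and> ys n = ?E `` {z}"
    using ys unfolding topspace_quotient_space topspace_weak_star_ball quotient_def by blast
  from choice[OF this] obtain zs where zs: "\<forall>n. zs n \<in> dual_ball V N \<and> ys n = ?E `` {zs n}"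
    by (elim exE)
  have zsA: "zs n (unit_vec j) = xs n (unit_vec j)" if "j \<in> A" for n j
  proof -
    have "?E' `` {zs n} = ?E' `` {xs n}" using zs ys \<pi>x[of "zs n"] by metis
    then show ?thesis
      using that zs xs coords.agree_class_eq_iff[of "zs n" "xs n" A] by (simp add: topspace_weak_star_ball)
  qed
  \<comment> \<open>The representatives \<open>zs n\<close> need not converge in the ball, only
    their classes do. As \<open>i \<in> B\<close>, the coordinate at \<open>i\<close> is continuous
    on the quotient by \<open>agree B\<close>, and so it converges along the lift.\<close>
  obtain g where g: "continuous_map (quotient_space ?K ?E) euclideanreal g"
    and gz: "\<forall>z\<in>dual_ball V N. g (?E `` {z}) = z (unit_vec i)"
    using coords.coordinate_on_quotient[of i B] B unfolding topspace_weak_star_ball by auto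
  have "(\<lambda>n. g (ys n)) \<longlonglongrightarrow> g (?E `` {y})"
    using continuous_map_limit[OF g ys_lim] by (simp add: o_def)
  moreover have "g (?E `` {y}) = c" using gz y yc[OF i(1)] by simp
  moreover have "g (ys n) = zs n (unit_vec i)" for n using gz zs by simp
  ultimately have zc: "(\<lambda>n. zs n (unit_vec i)) \<longlonglongrightarrow> c" by simp
  \<comment> \<open>On \<open>A\<close> the lift repeats the entries of \<open>xs n\<close>, so its
    entry at \<open>i\<close> has to share the unit mass with all of \<open>xs n\<close>.\<close>
  have upper: "mass (xs n) \<Gamma> \<le> 1 - \<bar>zs n (unit_vec i)\<bar> powr q" for n
  proof (rule mass_le[OF bf(1) order_refl])
    fix F assume F: "finite F" "F \<subseteq> \<Gamma>"
    have "(\<Sum>j\<in>F. \<bar>xs n (unit_vec j)\<bar> powr q) = (\<Sum>j\<in>F \<inter> A. \<bar>xs n (unit_vec j)\<bar> powr q)"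
      using F xs0 by (intro sum.mono_neutral_right) auto
    also have "\<dots> = (\<Sum>j\<in>F \<inter> A. \<bar>zs n (unit_vec j)\<bar> powr q)"
      by (intro sum.cong) (auto simp: zsA)
    finally have "(\<Sum>j\<in>F. \<bar>xs n (unit_vec j)\<bar> powr q) + \<bar>zs n (unit_vec i)\<bar> powr q =
        (\<Sum>j\<in>insert i (F \<inter> A). \<bar>zs n (unit_vec j)\<bar> powr q)"
      using F i by simp
    also have "\<dots> \<le> 1" using zs F i by (intro dual_ball_sum_le_1) auto
    finally show "(\<Sum>j\<in>F. \<bar>xs n (unit_vec j)\<bar> powr q) \<le> 1 - \<bar>zs n (unit_vec i)\<bar> powr q" by simp
  qed
  have "(\<lambda>n. 1 - \<bar>zs n (unit_vec i)\<bar> powr q) \<longlonglongrightarrow> 1 - \<bar>c\<bar> powr q"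
    using q_ge_1 by (intro tendsto_diff tendsto_const tendsto_powr' tendsto_rabs zc) auto
  then have up_lim: "(\<lambda>n. 1 - \<bar>zs n (unit_vec i)\<bar> powr q) \<longlonglongrightarrow> mass x \<Gamma>"
    using c by (simp add: m_def)
  have "(\<lambda>n. mass (xs n) \<Gamma>) \<longlonglongrightarrow> mass x \<Gamma>"
  proof (rule order_tendstoI)
    fix a assume "a < mass x \<Gamma>"
    then show "\<forall>\<^sub>F n in sequentially. a < mass (xs n) \<Gamma>"
      by (intro mass_lower_semicontinuous[OF bf order_refl conv])
  next
    fix a assume "mass x \<Gamma> < a"
    with up_lim have "\<forall>\<^sub>F n in sequentially. 1 - \<bar>zs n (unit_vec i)\<bar> powr q < a"
      by (rule order_tendstoD)
    then show "\<forall>\<^sub>F n in sequentially. mass (xs n) \<Gamma> < a"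
      by eventually_elim (rule le_less_trans[OF upper])
  qed
  then have "(\<lambda>n. dual_norm V N (xs n)) \<longlonglongrightarrow> dual_norm V N x"
    using dual_norm_tendsto_iff[OF bf] by simp
  with x lim show ?thesis by (rule that)
qed

lemma fiber_convergent_iff:
  assumes "\<And>n. xs n \<in> dual_ball V N"
  shows "fiber_convergent (weak_star_ball V N) xs \<longleftrightarrow>
    (\<exists>x\<in>dual_ball V N. limitin (weak_star_ball V N) xs x sequentially \<and>
      (\<lambda>n. dual_norm V N (xs n)) \<longlonglongrightarrow> dual_norm V N x)"
proof
  assume "fiber_convergent (weak_star_ball V N) xs"
  then obtain x where "x \<in> dual_ball V N" "limitin (weak_star_ball V N) xs x sequentially"
    "(\<lambda>n. dual_norm V N (xs n)) \<longlonglongrightarrow> dual_norm V N x"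
    by (rule fiber_convergentD[OF assms])
  then show "\<exists>x\<in>dual_ball V N. limitin (weak_star_ball V N) xs x sequentially \<and>
      (\<lambda>n. dual_norm V N (xs n)) \<longlonglongrightarrow> dual_norm V N x" by (intro bexI conjI)
next
  assume "\<exists>x\<in>dual_ball V N. limitin (weak_star_ball V N) xs x sequentially \<and>
      (\<lambda>n. dual_norm V N (xs n)) \<longlonglongrightarrow> dual_norm V N x"
  then show "fiber_convergent (weak_star_ball V N) xs"
    by (elim bexE conjE) (rule fiber_convergentI[OF assms])
qed

lemma class_E0_space: "class_E0 V N"
  unfolding class_E0_def using banach_space not_separable fiber_convergent_iff by simp

lemma class_E_space: "class_E V N"
  unfolding class_E_def
proof (intro conjI allI impI)
  fix xs :: "nat \<Rightarrow> ('i \<Rightarrow> real) \<Rightarrow> real" assume "\<forall>n. xs n \<in> dual_ball V N"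
  then have xs: "\<And>n. xs n \<in> dual_ball V N" by simp
  show "fiber_convergent (weak_star_ball V N) xs \<longleftrightarrow>
      (\<exists>x\<in>dual_ball V N. (\<lambda>n. dual_norm V N (\<lambda>v. xs n v - x v)) \<longlonglongrightarrow> 0)"
    unfolding fiber_convergent_iff[OF xs] using norm_convergent_iff[OF xs] by simp
qed (fact banach_space not_separable)+

end

section \<open>The spaces \<open>c\<^sub>0(\<Gamma>)\<close> and \<open>\<ell>\<^sub>p(\<Gamma>)\<close>\<close>

text \<open>The inserted 0 supplies the value on the empty set.\<close>

definition max_seminorm :: "'i set \<Rightarrow> ('i \<Rightarrow> real) \<Rightarrow> real" where
  "max_seminorm F f = Max (insert 0 ((\<lambda>i. \<bar>f i\<bar>) ` F))"

lemma max_seminorm_le_iff: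
  "finite F \<Longrightarrow> max_seminorm F f \<le> c \<longleftrightarrow> 0 \<le> c \<and> (\<forall>i\<in>F. \<bar>f i\<bar> \<le> c)"
  by (simp add: max_seminorm_def)

text \<open>Finite duality of the maximum norm and the sum norm: a function is normed by a signed
  unit vector at an index where its maximum is attained, and a vector \<open>a\<close> by its sign
  pattern.\<close>

lemma lq_dual_seminorms_max: "lq_dual_seminorms 1 max_seminorm"
proof
  fix F :: "'i set" and a f :: "'i \<Rightarrow> real"
  assume F: "finite F"
  have M: "0 \<le> max_seminorm F f" "\<And>i. i \<in> F \<Longrightarrow> \<bar>f i\<bar> \<le> max_seminorm F f"
    using max_seminorm_le_iff[OF F, of f "max_seminorm F f"] by auto
  {
    assume a: "(\<Sum>i\<in>F. \<bar>a i\<bar> powr 1) \<le> 1"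
    have "(\<Sum>i\<in>F. a i * f i) \<le> (\<Sum>i\<in>F. \<bar>a i\<bar> * max_seminorm F f)"
    proof (rule sum_mono)
      fix i assume "i \<in> F"
      have "a i * f i \<le> \<bar>a i\<bar> * \<bar>f i\<bar>" by (metis abs_ge_self abs_mult)
      also have "\<dots> \<le> \<bar>a i\<bar> * max_seminorm F f" using M(2)[OF \<open>i \<in> F\<close>] by (intro mult_left_mono) auto
      finally show "a i * f i \<le> \<bar>a i\<bar> * max_seminorm F f" .
    qed
    also have "\<dots> = (\<Sum>i\<in>F. \<bar>a i\<bar>) * max_seminorm F f" by (simp add: sum_distrib_right)
    also have "\<dots> \<le> 1 * max_seminorm F f" using a M(1) by (intro mult_right_mono) auto
    finally show "(\<Sum>i\<in>F. a i * f i) \<le> max_seminorm F f" by simp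
  }
  show "\<exists>a. (\<Sum>i\<in>F. \<bar>a i\<bar> powr 1) \<le> 1 \<and> max_seminorm F f = (\<Sum>i\<in>F. a i * f i)"
  proof (cases "max_seminorm F f = 0")
    case True
    then show ?thesis by (intro exI[of _ "\<lambda>_. 0"]) simp
  next
    case False
    have "max_seminorm F f \<in> insert 0 ((\<lambda>i. \<bar>f i\<bar>) ` F)"
      unfolding max_seminorm_def using F by (intro Max_in) auto
    then obtain j where j: "j \<in> F" "max_seminorm F f = \<bar>f j\<bar>" using False by auto
    let ?a = "\<lambda>i. if i = j then sgn (f j) else 0"
    have "(\<Sum>i\<in>F. \<bar>?a i\<bar> powr 1) = (\<Sum>i\<in>{j}. \<bar>?a i\<bar> powr 1)"
      using F j by (intro sum.mono_neutral_right) auto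
    also have "\<dots> \<le> 1" by (simp add: sgn_if)
    finally have 1: "(\<Sum>i\<in>F. \<bar>?a i\<bar> powr 1) \<le> 1" .
    have "(\<Sum>i\<in>F. ?a i * f i) = (\<Sum>i\<in>{j}. ?a i * f i)"
      using F j by (intro sum.mono_neutral_right) auto
    then have "max_seminorm F f = (\<Sum>i\<in>F. ?a i * f i)" using j(2) by (simp add: sgn_if)
    with 1 show ?thesis by (intro exI[of _ ?a] conjI)
  qed
  show "\<exists>f. max_seminorm F f \<le> 1 \<and>
      (\<Sum>i\<in>F. a i * f i) = (\<Sum>i\<in>F. \<bar>a i\<bar> powr 1) powr (1 / 1)"
  proof (intro exI conjI)
    show "max_seminorm F (\<lambda>i. sgn (a i)) \<le> 1"
      using F by (simp add: max_seminorm_le_iff sgn_if)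
    have "(\<Sum>i\<in>F. a i * sgn (a i)) = (\<Sum>i\<in>F. \<bar>a i\<bar>)"
      by (intro sum.cong) (auto simp: sgn_if)
    then show "(\<Sum>i\<in>F. a i * sgn (a i)) = (\<Sum>i\<in>F. \<bar>a i\<bar> powr 1) powr (1 / 1)"
      by (simp add: sum_nonneg)
  qed
qed simp

lemma lq_dual_space_c0:
  fixes \<Gamma> :: "'i set"
  assumes "uncountable \<Gamma>"
  shows "lq_dual_space 1 max_seminorm \<Gamma> (c0_space \<Gamma>) (c0_norm \<Gamma>)"
proof (intro lq_dual_space.intro lq_dual_seminorms_max lq_dual_space_axioms.intro)
  show "f \<in> c0_space \<Gamma> \<longleftrightarrow> (\<forall>i. i \<notin> \<Gamma> \<longrightarrow> f i = 0) \<and>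
      (\<forall>\<epsilon>>0. \<exists>F. finite F \<and> F \<subseteq> \<Gamma> \<and> (\<forall>G. finite G \<and> G \<subseteq> \<Gamma> - F \<longrightarrow> max_seminorm G f \<le> \<epsilon>))"
    for f
  proof -
    have "(\<forall>\<epsilon>>0. finite {i \<in> \<Gamma>. \<epsilon> \<le> \<bar>f i\<bar>}) \<longleftrightarrow>
      (\<forall>\<epsilon>>0. \<exists>F. finite F \<and> F \<subseteq> \<Gamma> \<and> (\<forall>G. finite G \<and> G \<subseteq> \<Gamma> - F \<longrightarrow> max_seminorm G f \<le> \<epsilon>))"
    proof (intro iffI allI impI)
      fix \<epsilon> :: real assume fin: "\<forall>\<epsilon>>0. finite {i \<in> \<Gamma>. \<epsilon> \<le> \<bar>f i\<bar>}" and "\<epsilon> > 0"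
      have "max_seminorm G f \<le> \<epsilon>" if "finite G" "G \<subseteq> \<Gamma> - {i \<in> \<Gamma>. \<epsilon> \<le> \<bar>f i\<bar>}" for G
        using that \<open>\<epsilon> > 0\<close> by (force simp: max_seminorm_le_iff)
      then show "\<exists>F. finite F \<and> F \<subseteq> \<Gamma> \<and> (\<forall>G. finite G \<and> G \<subseteq> \<Gamma> - F \<longrightarrow> max_seminorm G f \<le> \<epsilon>)"
        using fin \<open>\<epsilon> > 0\<close> by (intro exI[of _ "{i \<in> \<Gamma>. \<epsilon> \<le> \<bar>f i\<bar>}"]) simp
    next
      fix \<epsilon> :: real
      assume R: "\<forall>\<epsilon>>0. \<exists>F. finite F \<and> F \<subseteq> \<Gamma> \<and>
          (\<forall>G. finite G \<and> G \<subseteq> \<Gamma> - F \<longrightarrow> max_seminorm G f \<le> \<epsilon>)"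
        and "\<epsilon> > 0"
      \<comment> \<open>The defining level sets of \<open>c0_space\<close> contain the indices with
        \<open>\<bar>f i\<bar> = \<epsilon>\<close>; the bound \<open>\<epsilon> / 2\<close>
        excludes these as well.\<close>
      then obtain F where F: "finite F"
        "\<forall>G. finite G \<and> G \<subseteq> \<Gamma> - F \<longrightarrow> max_seminorm G f \<le> \<epsilon> / 2"
        using half_gt_zero by meson
      have "i \<in> F" if "i \<in> \<Gamma>" "\<epsilon> \<le> \<bar>f i\<bar>" for i
      proof (rule ccontr)
        assume "i \<notin> F"
        then have "max_seminorm {i} f \<le> \<epsilon> / 2" using F(2) that by simp
        then have "\<bar>f i\<bar> \<le> \<epsilon> / 2" by (subst (asm) max_seminorm_le_iff) auto
        then show False using that \<open>\<epsilon> > 0\<close> by simp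
      qed
      then show "finite {i \<in> \<Gamma>. \<epsilon> \<le> \<bar>f i\<bar>}" using F(1) by (auto intro: finite_subset)
    qed
    then show ?thesis unfolding c0_space_def by simp
  qed
  have ne: "\<Gamma> \<noteq> {}" using assms by auto
  show "max_seminorm F f \<le> c0_norm \<Gamma> f" if f: "f \<in> c0_space \<Gamma>" and F: "finite F" "F \<subseteq> \<Gamma>" for f F
  proof -
    \<comment> \<open>Finiteness of the level set at 1 makes \<open>f\<close> bounded, so the
      supremum in \<open>c0_norm\<close> is a genuine one.\<close>
    have "finite {i \<in> \<Gamma>. 1 \<le> \<bar>f i\<bar>}" using f unfolding c0_space_def by simp
    then have "bdd_above ((\<lambda>i. \<bar>f i\<bar>) ` {i \<in> \<Gamma>. 1 \<le> \<bar>f i\<bar>})" by simp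
    then obtain C where C: "\<And>i. i \<in> \<Gamma> \<Longrightarrow> 1 \<le> \<bar>f i\<bar> \<Longrightarrow> \<bar>f i\<bar> \<le> C" unfolding bdd_above_def by auto
    have "\<bar>f i\<bar> \<le> max 1 C" if "i \<in> \<Gamma>" for i
      using C[OF that] by (cases "1 \<le> \<bar>f i\<bar>") auto
    then have "bdd_above ((\<lambda>i. \<bar>f i\<bar>) ` \<Gamma>)" by (rule bdd_aboveI2)
    then have le: "\<bar>f i\<bar> \<le> c0_norm \<Gamma> f" if "i \<in> \<Gamma>" for i
      unfolding c0_norm_def using that by (intro cSUP_upper)
    obtain j where "j \<in> \<Gamma>" using ne by blast
    then have "0 \<le> c0_norm \<Gamma> f" using le[of j] by simp
    then show ?thesis using F le by (auto simp: max_seminorm_le_iff)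
  qed
  show "c0_norm \<Gamma> f \<le> c" if "\<And>F. finite F \<Longrightarrow> F \<subseteq> \<Gamma> \<Longrightarrow> max_seminorm F f \<le> c" for f c
    unfolding c0_norm_def
  proof (rule cSUP_least[OF ne])
    fix i assume "i \<in> \<Gamma>"
    then show "\<bar>f i\<bar> \<le> c" using that[of "{i}"] by (simp add: max_seminorm_le_iff)
  qed
qed (fact assms)

section \<open>Finite Hoelder duality of conjugate exponents\<close>

definition lp_seminorm :: "real \<Rightarrow> 'i set \<Rightarrow> ('i \<Rightarrow> real) \<Rightarrow> real" where
  "lp_seminorm p F f = (\<Sum>i\<in>F. \<bar>f i\<bar> powr p) powr (1 / p)"

lemma sum_powr_zeroD:
  fixes f :: "'i \<Rightarrow> real"
  assumes "finite F" "(\<Sum>i\<in>F. \<bar>f i\<bar> powr p) = 0" "i \<in> F"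
  shows "f i = 0"
  using assms by (simp add: sum_nonneg_eq_0_iff)

text \<open>Young's inequality for \<open>\<bar>f i\<bar> / s\<close> and
  \<open>\<bar>a i\<bar>\<close>, where \<open>s\<close> is the norm of \<open>f\<close>, summed
  over \<open>F\<close>; the weights \<open>1 / p\<close> and \<open>1 / q\<close> add up to
  1.\<close>

lemma lp_hoelder:
  fixes a f :: "'i \<Rightarrow> real"
  assumes p: "1 < p" and q: "1 < q" and conj: "1 / p + 1 / q = 1" and F: "finite F"
    and a: "(\<Sum>i\<in>F. \<bar>a i\<bar> powr q) \<le> 1"
  shows "(\<Sum>i\<in>F. a i * f i) \<le> lp_seminorm p F f"
proof (cases "(\<Sum>i\<in>F. \<bar>f i\<bar> powr p) = 0")
  case True
  then have "(\<Sum>i\<in>F. a i * f i) = (\<Sum>i\<in>F. 0)"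
    using sum_powr_zeroD[OF F True] by (intro sum.cong) auto
  then show ?thesis by (simp add: lp_seminorm_def)
next
  case False
  define S where "S = (\<Sum>i\<in>F. \<bar>f i\<bar> powr p)"
  define s where "s = S powr (1 / p)"
  have S: "S > 0" using False unfolding S_def by (simp add: order_less_le sum_nonneg)
  have s: "s > 0" "s powr p = S" using S p by (auto simp: s_def powr_powr)
  have young: "a i * f i \<le> s * (\<bar>a i\<bar> powr q / q + \<bar>f i\<bar> powr p / S / p)" for i
  proof -
    have "(\<bar>f i\<bar> / s) * \<bar>a i\<bar> \<le> (\<bar>f i\<bar> / s) powr p / p + \<bar>a i\<bar> powr q / q"
      using p q conj s by (intro Youngs_inequality) auto
    also have "(\<bar>f i\<bar> / s) powr p = \<bar>f i\<bar> powr p / S" using s by (simp add: powr_divide)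
    finally have "s * ((\<bar>f i\<bar> / s) * \<bar>a i\<bar>) \<le> s * (\<bar>f i\<bar> powr p / S / p + \<bar>a i\<bar> powr q / q)"
      using s(1) by (intro mult_left_mono) auto
    moreover have "s * ((\<bar>f i\<bar> / s) * \<bar>a i\<bar>) = \<bar>a i * f i\<bar>" using s(1) by (simp add: abs_mult)
    ultimately show ?thesis using abs_ge_self[of "a i * f i"] by (simp add: add.commute)
  qed
  have "(\<Sum>i\<in>F. a i * f i) \<le> (\<Sum>i\<in>F. s * (\<bar>a i\<bar> powr q / q + \<bar>f i\<bar> powr p / S / p))"
    by (intro sum_mono young)
  also have "\<dots> = s * ((\<Sum>i\<in>F. \<bar>a i\<bar> powr q) / q + S / S / p)"
    by (simp add: sum_distrib_left[symmetric] sum.distrib sum_divide_distrib[symmetric] S_def)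
  also have "\<dots> \<le> s * (1 / q + 1 / p)"
    using a p q S s(1) by (intro mult_left_mono add_mono divide_right_mono) auto
  also have "\<dots> = s" using conj by (simp add: add.commute)
  finally show ?thesis by (simp add: lp_seminorm_def s_def S_def)
qed

lemma lp_norming:
  fixes f :: "'i \<Rightarrow> real"
  assumes p: "1 < p" and q: "1 < q" and conj: "1 / p + 1 / q = 1" and F: "finite F"
  shows "\<exists>a. (\<Sum>i\<in>F. \<bar>a i\<bar> powr q) \<le> 1 \<and> lp_seminorm p F f = (\<Sum>i\<in>F. a i * f i)"
proof (cases "(\<Sum>i\<in>F. \<bar>f i\<bar> powr p) = 0")
  case True
  then show ?thesis by (intro exI[of _ "\<lambda>_. 0"]) (simp add: lp_seminorm_def)
next
  case False
  define S where "S = (\<Sum>i\<in>F. \<bar>f i\<bar> powr p)"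
  have S: "S > 0" using False unfolding S_def by (simp add: order_less_le sum_nonneg)
  \<comment> \<open>The extremal vector of Hoelder's inequality, normalised to have
    \<open>q\<close>-sum 1.\<close>
  define a where "a i = sgn (f i) * \<bar>f i\<bar> powr (p - 1) / S powr (1 / q)" for i
  have pq: "(p - 1) * q = p" using conj p q by (simp add: field_simps)
  have "\<bar>a i\<bar> powr q = \<bar>f i\<bar> powr p / S" for i
  proof (cases "f i = 0")
    case True
    then show ?thesis by (simp add: a_def)
  next
    case False
    then have "\<bar>a i\<bar> = \<bar>f i\<bar> powr (p - 1) / S powr (1 / q)"
      by (simp add: a_def abs_mult abs_sgn_eq)
    then show ?thesis using S q by (simp add: powr_divide powr_powr pq)
  qed
  then have "(\<Sum>i\<in>F. \<bar>a i\<bar> powr q) = S / S" by (simp add: sum_divide_distrib[symmetric] S_def)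
  then have 1: "(\<Sum>i\<in>F. \<bar>a i\<bar> powr q) \<le> 1" using S by simp
  have "a i * f i = \<bar>f i\<bar> powr p / S powr (1 / q)" for i
  proof (cases "f i = 0")
    case True
    then show ?thesis by simp
  next
    case False
    have "\<bar>f i\<bar> powr p = \<bar>f i\<bar> powr (p - 1) * \<bar>f i\<bar> powr 1"
      unfolding powr_add[symmetric] by simp
    then show ?thesis using False by (simp add: a_def sgn_if)
  qed
  then have "(\<Sum>i\<in>F. a i * f i) = S / S powr (1 / q)"
    by (simp add: sum_divide_distrib[symmetric] S_def)
  also have "\<dots> = S powr (1 - 1 / q)" using S by (simp add: powr_diff)
  also have "1 - 1 / q = 1 / p" using conj by simp
  finally have "lp_seminorm p F f = (\<Sum>i\<in>F. a i * f i)" by (simp add: lp_seminorm_def S_def)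
  with 1 show ?thesis by (intro exI[of _ a] conjI)
qed

lemma lq_dual_seminorms_lp:
  assumes p: "1 < p" and q: "1 < q" and conj: "1 / p + 1 / q = 1"
  shows "lq_dual_seminorms q (lp_seminorm p)"
proof
  show "1 \<le> q" using q by simp
next
  fix F :: "'i set" and a f :: "'i \<Rightarrow> real"
  assume F: "finite F"
  show "(\<Sum>i\<in>F. \<bar>a i\<bar> powr q) \<le> 1 \<Longrightarrow> (\<Sum>i\<in>F. a i * f i) \<le> lp_seminorm p F f"
    using lp_hoelder[OF p q conj F] .
  show "\<exists>a. (\<Sum>i\<in>F. \<bar>a i\<bar> powr q) \<le> 1 \<and> lp_seminorm p F f = (\<Sum>i\<in>F. a i * f i)"
    using lp_norming[OF p q conj F] .
  \<comment> \<open>\<open>dual_norming\<close> is \<open>norming\<close> with the exponents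
    exchanged.\<close>
  have "1 / q + 1 / p = 1" using conj by simp
  from lp_norming[OF q p this F, of a] obtain g
    where g: "(\<Sum>i\<in>F. \<bar>g i\<bar> powr p) \<le> 1" "lp_seminorm q F a = (\<Sum>i\<in>F. g i * a i)" by blast
  have "lp_seminorm p F g \<le> 1 powr (1 / p)"
    unfolding lp_seminorm_def using p g(1) by (intro powr_mono2) (auto intro: sum_nonneg)
  moreover have "(\<Sum>i\<in>F. a i * g i) = (\<Sum>i\<in>F. \<bar>a i\<bar> powr q) powr (1 / q)"
    using g(2) by (simp add: lp_seminorm_def mult.commute)
  ultimately show "\<exists>f. lp_seminorm p F f \<le> 1 \<and>
      (\<Sum>i\<in>F. a i * f i) = (\<Sum>i\<in>F. \<bar>a i\<bar> powr q) powr (1 / q)"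
    by (intro exI[of _ g]) simp
qed

lemma lp_seminorm_le_iff:
  assumes "1 < p" "0 \<le> c"
  shows "lp_seminorm p F f \<le> c \<longleftrightarrow> (\<Sum>i\<in>F. \<bar>f i\<bar> powr p) \<le> c powr p"
proof
  have S: "0 \<le> (\<Sum>i\<in>F. \<bar>f i\<bar> powr p)" by (simp add: sum_nonneg)
  {
    assume "lp_seminorm p F f \<le> c"
    then have "lp_seminorm p F f powr p \<le> c powr p"
      using assms by (intro powr_mono2) (auto simp: lp_seminorm_def)
    then show "(\<Sum>i\<in>F. \<bar>f i\<bar> powr p) \<le> c powr p"
      using assms S by (simp add: lp_seminorm_def powr_powr)
  next
    assume "(\<Sum>i\<in>F. \<bar>f i\<bar> powr p) \<le> c powr p"
    then have "lp_seminorm p F f \<le> (c powr p) powr (1 / p)"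
      unfolding lp_seminorm_def using assms S by (intro powr_mono2) auto
    then show "lp_seminorm p F f \<le> c" using assms by (simp add: powr_powr)
  }
qed

text \<open>\<open>p / (p - 1)\<close> is the exponent conjugate to \<open>p\<close>. The tail
  condition is the Cauchy criterion for summability of the \<open>p\<close>-th powers.\<close>

lemma lq_dual_space_lp:
  fixes \<Gamma> :: "'i set"
  assumes "uncountable \<Gamma>" and p: "1 < p"
  shows "lq_dual_space (p / (p - 1)) (lp_seminorm p) \<Gamma> (lp_space p \<Gamma>) (lp_norm p \<Gamma>)"
proof (intro lq_dual_space.intro lq_dual_space_axioms.intro)
  show "lq_dual_seminorms (p / (p - 1)) (lp_seminorm p)"
    using p by (intro lq_dual_seminorms_lp) (auto simp: field_simps)
  show "f \<in> lp_space p \<Gamma> \<longleftrightarrow> (\<forall>i. i \<notin> \<Gamma> \<longrightarrow> f i = 0) \<and>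
      (\<forall>\<epsilon>>0. \<exists>F. finite F \<and> F \<subseteq> \<Gamma> \<and> (\<forall>G. finite G \<and> G \<subseteq> \<Gamma> - F \<longrightarrow> lp_seminorm p G f \<le> \<epsilon>))"
    for f
  proof -
    let ?g = "\<lambda>i. \<bar>f i\<bar> powr p"
    have "?g summable_on \<Gamma> \<longleftrightarrow>
      (\<forall>\<epsilon>>0. \<exists>F. finite F \<and> F \<subseteq> \<Gamma> \<and> (\<forall>G. finite G \<and> G \<subseteq> \<Gamma> - F \<longrightarrow> lp_seminorm p G f \<le> \<epsilon>))"
    proof (intro iffI allI impI)
      fix \<epsilon> :: real assume sm: "?g summable_on \<Gamma>" and "\<epsilon> > 0"
      have "\<exists>F. finite F \<and> F \<subseteq> \<Gamma> \<and> infsum ?g \<Gamma> - \<epsilon> powr p < sum ?g F"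
      proof (rule ccontr)
        assume none: "\<not> ?thesis"
        have "infsum ?g \<Gamma> \<le> infsum ?g \<Gamma> - \<epsilon> powr p"
          by (rule infsum_le_finite_sums[OF sm]) (use none in \<open>meson not_less\<close>)
        then show False using \<open>\<epsilon> > 0\<close> by simp
      qed
      then obtain F where F: "finite F" "F \<subseteq> \<Gamma>" "infsum ?g \<Gamma> - \<epsilon> powr p < sum ?g F" by blast
      have "lp_seminorm p G f \<le> \<epsilon>" if G: "finite G" "G \<subseteq> \<Gamma> - F" for G
      proof -
        have "sum ?g F + sum ?g G = sum ?g (F \<union> G)"
          using F G by (intro sum.union_disjoint[symmetric]) auto
        also have "\<dots> \<le> infsum ?g \<Gamma>" using F G by (intro finite_sum_le_infsum sm) auto
        finally show ?thesis using F(3) p \<open>\<epsilon> > 0\<close> by (simp add: lp_seminorm_le_iff)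
      qed
      then show "\<exists>F. finite F \<and> F \<subseteq> \<Gamma> \<and> (\<forall>G. finite G \<and> G \<subseteq> \<Gamma> - F \<longrightarrow> lp_seminorm p G f \<le> \<epsilon>)"
        using F by (intro exI[of _ F]) simp
    next
      assume "\<forall>\<epsilon>>0. \<exists>F. finite F \<and> F \<subseteq> \<Gamma> \<and>
          (\<forall>G. finite G \<and> G \<subseteq> \<Gamma> - F \<longrightarrow> lp_seminorm p G f \<le> \<epsilon>)"
      \<comment> \<open>A single tail bound, at level 1, already bounds all finite sums, and the
        terms are nonnegative.\<close>
      then obtain F where F: "finite F"
        "\<forall>G. finite G \<and> G \<subseteq> \<Gamma> - F \<longrightarrow> lp_seminorm p G f \<le> 1"
        using zero_less_one by meson
      have "sum ?g H \<le> sum ?g F + 1" if H: "finite H" "H \<subseteq> \<Gamma>" for H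
      proof -
        have "sum ?g H \<le> sum ?g (F \<union> (H - F))" using F H by (intro sum_mono2) auto
        also have "\<dots> = sum ?g F + sum ?g (H - F)" using F H by (intro sum.union_disjoint) auto
        also have "sum ?g (H - F) \<le> 1"
        proof -
          have "lp_seminorm p (H - F) f \<le> 1" using F H by blast
          then show ?thesis using p by (simp add: lp_seminorm_le_iff)
        qed
        finally show ?thesis by simp
      qed
      then show "?g summable_on \<Gamma>"
        by (intro nonneg_bdd_above_summable_on bdd_aboveI2[of _ _ "sum ?g F + 1"]) auto
    qed
    then show ?thesis unfolding lp_space_def by simp
  qed
  fix f assume f: "f \<in> lp_space p \<Gamma>"
  then have sm: "(\<lambda>i. \<bar>f i\<bar> powr p) summable_on \<Gamma>" by (simp add: lp_space_def)
  have nn: "0 \<le> (\<Sum>\<^sub>\<infinity>i\<in>\<Gamma>. \<bar>f i\<bar> powr p)" by (intro infsum_nonneg) auto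
  show "lp_seminorm p F f \<le> lp_norm p \<Gamma> f" if F: "finite F" "F \<subseteq> \<Gamma>" for F
    unfolding lp_seminorm_def lp_norm_def using p F
    by (intro powr_mono2 finite_sum_le_infsum sm sum_nonneg) auto
  show "lp_norm p \<Gamma> f \<le> c"
    if c: "\<And>F. finite F \<Longrightarrow> F \<subseteq> \<Gamma> \<Longrightarrow> lp_seminorm p F f \<le> c" for c
  proof -
    have c0: "0 \<le> c" using c[of "{}"] by (simp add: lp_seminorm_def)
    have "(\<Sum>\<^sub>\<infinity>i\<in>\<Gamma>. \<bar>f i\<bar> powr p) \<le> c powr p"
      using c lp_seminorm_le_iff[OF p c0] by (intro infsum_le_finite_sums sm) blast
    then have "lp_norm p \<Gamma> f \<le> (c powr p) powr (1 / p)"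
      unfolding lp_norm_def using p nn by (intro powr_mono2) auto
    then show ?thesis using p c0 by (simp add: powr_powr)
  qed
qed (fact assms)

theorem mainTheorem4:
  fixes \<Gamma> :: "'i set"
  assumes "uncountable \<Gamma>"
  shows "class_E (c0_space \<Gamma>) (c0_norm \<Gamma>) \<and> class_E0 (c0_space \<Gamma>) (c0_norm \<Gamma>) \<and>
    (\<forall>p::real. 1 < p \<longrightarrow>
       class_E (lp_space p \<Gamma>) (lp_norm p \<Gamma>) \<and> class_E0 (lp_space p \<Gamma>) (lp_norm p \<Gamma>))"
proof (intro conjI allI impI)
  interpret c0: lq_dual_space 1 max_seminorm \<Gamma> "c0_space \<Gamma>" "c0_norm \<Gamma>"
    by (rule lq_dual_space_c0[OF assms])
  show "class_E (c0_space \<Gamma>) (c0_norm \<Gamma>)" by (rule c0.class_E_space)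
  show "class_E0 (c0_space \<Gamma>) (c0_norm \<Gamma>)" by (rule c0.class_E0_space)
next
  fix p :: real assume "1 < p"
  then interpret lp: lq_dual_space "p / (p - 1)" "lp_seminorm p" \<Gamma> "lp_space p \<Gamma>" "lp_norm p \<Gamma>"
    by (rule lq_dual_space_lp[OF assms])
  show "class_E (lp_space p \<Gamma>) (lp_norm p \<Gamma>)" by (rule lp.class_E_space)
  show "class_E0 (lp_space p \<Gamma>) (lp_norm p \<Gamma>)" by (rule lp.class_E0_space)
qed

end
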